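(* Let $\mathcal{D}_3\subset\mathbb{C}^7$ be the set of points $(a_3,\dots,a_9)$ satisfying $$\begin{aligned} a_3a_9-2a_4a_8+a_5a_7&=0,\\ a_5a_6-2a_4a_7+a_3a_8&=0,\\ 9a_3-a_3a_4^2+a_3^2a_5+6a_6a_8-6a_7^2&=0,\\ 9a_4-a_4^3+a_3a_4a_5+3a_6a_9-3a_7a_8&=0,\\ 9a_5-a_4^2a_5+a_3a_5^2+6a_7a_9-6a_8^2&=0. \end{aligned}$$ Then the group $G$ acts transitively on $\mathbb{C}^2\times\mathcal{D}_3$, i.e. on the set of $(a_1,\dots,a_9)\in\mathbb{C}^9$ satisfying these five relations.
   Context: $\mathcal{M}_3$ is the algebra of complex $3\times3$ matrices; $\mathrm{GL}_3=\mathrm{GL}_3(\mathbb{C})$ acts on $\mathcal{M}_3\times\mathcal{M}_3$ by simultaneous conjugation. For $(X,Y)$ put $A=X-\frac13\mathrm{Tr}(X)I_3$, $B=Y-\frac13\mathrm{Tr}(Y)I_3$ and $a_1=\mathrm{Tr}(X)$, $a_2=\mathrm{Tr}(Y)$, $a_3=\mathrm{Tr}(A^2)$, $a_4=\mathrm{Tr}(AB)$, $a_5=\mathrm{Tr}(B^2)$, $a_6=\mathrm{Tr}(A^3)$, $a_7=\mathrm{Tr}(A^2B)$, $a_8=\mathrm{Tr}(AB^2)$, $a_9=\mathrm{Tr}(B^3)$, $v=\mathrm{Tr}(A^2B^2)-\mathrm{Tr}(ABAB)$, $w=\mathrm{Tr}(A^2B^2AB)-\mathrm{Tr}(A^2BAB^2)$.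 The functions $(a_1,\dots,a_9,v,w)$ identify $(\mathcal{M}_3\times\mathcal{M}_3)/\!/\mathrm{GL}_3$ with the hypersurface in $\mathbb{C}^{11}$ $$w^2+\tfrac{4v^3}{27}-\tfrac1{27}(r_3r_5-r_4^2)-\tfrac1{18}(a_3r_1^2-2a_4r_1r_2+a_5r_2^2)=0,$$ where $r_1=a_3a_9-2a_4a_8+a_5a_7$, $r_2=a_3a_8-2a_4a_7+a_5a_6$, $r_3=a_3(a_3a_5-a_4^2-3v)+6(a_6a_8-a_7^2)$, $r_4=a_4(a_3a_5-a_4^2-3v)+3(a_6a_9-a_7a_8)$, $r_5=a_5(a_3a_5-a_4^2-3v)+6(a_7a_9-a_8^2)$. A point $(a_1,\dots,a_9)\in\mathbb{C}^2\times\mathcal{D}_3$ is regarded as the point of this hypersurface with $v=-3$, $w=2$ (for $v=-3$ the five relations say $r_1=\dots=r_5=0$). $G$ (the affine Cremona group) is the group generated by the automorphisms $\Phi_p$ ($x\mapsto x+p(y)$, $y\mapsto y$) and $\Psi_q$ ($x\mapsto x$, $y\mapsto y+q(x)$) of $\mathbb{C}[x,y]$, $p,q$ one-variable complex polynomials. It acts on $(\mathcal{M}_3\times\mathcal{M}_3)/\!/\mathrm{GL}_3$ via $\Phi_p:(X,Y)\mapsto(X+p(Y),Y)$, $\Psi_q:(X,Y)\mapsto(X,Y+q(X))$, leaving $v$ and $w$ invariant. *)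

theory Defs
  imports
    "HOL-Analysis.Analysis"
    "HOL-Computational_Algebra.Polynomial"
    "HOL-Algebra.Elementary_Groups"
    "HOL-Algebra.Group_Action"
begin

section \<open>The affine Cremona group\<close>

text \<open>
  The ring \<open>\<complex>[x, y]\<close> is represented as \<open>(\<complex>[x])[y]\<close>, i.e. by the type of polynomials in \<open>y\<close>
  whose coefficients are polynomials in \<open>x\<close>.
\<close>

type_synonym cpoly2 = "complex poly poly"

definition const2 :: "complex \<Rightarrow> cpoly2" where
  "const2 c = [:[:c:]:]"

definition var_x :: cpoly2 where
  "var_x = [:[:0, 1:]:]"

definition var_y :: cpoly2 where
  "var_y = [:0, 1:]"

definition eval1 :: "complex poly \<Rightarrow> cpoly2 \<Rightarrow> cpoly2" where
  "eval1 p f = poly (map_poly const2 p) f"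

text \<open>
  \<open>subst2 f g\<close> is the \<open>\<complex>\<close>-algebra endomorphism of \<open>\<complex>[x, y]\<close> with \<open>x \<mapsto> f\<close>, \<open>y \<mapsto> g\<close>.
\<close>

definition subst2 :: "cpoly2 \<Rightarrow> cpoly2 \<Rightarrow> cpoly2 \<Rightarrow> cpoly2" where
  "subst2 f g F = poly (map_poly (\<lambda>c. eval1 c f) F) g"

definition cpoly2_aut :: "(cpoly2 \<Rightarrow> cpoly2) monoid" where
  "cpoly2_aut = (BijGroup UNIV)\<lparr>carrier :=
     {\<sigma>. bij \<sigma> \<and> (\<forall>F H. \<sigma> (F + H) = \<sigma> F + \<sigma> H) \<and> (\<forall>F H. \<sigma> (F * H) = \<sigma> F * \<sigma> H) \<and>
         (\<forall>c. \<sigma> (const2 c) = const2 c)}\<rparr>"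

definition aut_Phi :: "complex poly \<Rightarrow> cpoly2 \<Rightarrow> cpoly2" where
  "aut_Phi p = subst2 (var_x + eval1 p var_y) var_y"

definition aut_Psi :: "complex poly \<Rightarrow> cpoly2 \<Rightarrow> cpoly2" where
  "aut_Psi q = subst2 var_x (var_y + eval1 q var_x)"

definition cremona_group :: "(cpoly2 \<Rightarrow> cpoly2) monoid" where
  "cremona_group = subgroup_generated cpoly2_aut (range aut_Phi \<union> range aut_Psi)"

definition opposite_group :: "'a monoid \<Rightarrow> 'a monoid" where
  "opposite_group G = G\<lparr>mult := (\<lambda>g h. h \<otimes>\<^bsub>G\<^esub> g)\<rparr>"


section \<open>The action on pairs of matrices\<close>

type_synonym mat3 = "complex^3^3"

text \<open>
  The operation \<open>(*)\<close>, and hence \<open>(^)\<close>, on this type is componentwise; the product of matrices is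
  \<open>(**)\<close>. The matrix \<open>c \<sqdot> I\<close> is \<open>mat c\<close>.
\<close>

definition mat_poly :: "complex poly \<Rightarrow> mat3 \<Rightarrow> mat3" where
  "mat_poly p M = (\<Sum>k\<le>degree p. mat (coeff p k) ** (((**) M ^^ k) (mat 1)))"

definition mat_Phi :: "complex poly \<Rightarrow> mat3 \<times> mat3 \<Rightarrow> mat3 \<times> mat3" where
  "mat_Phi p = (\<lambda>(X, Y). (X + mat_poly p Y, Y))"

definition mat_Psi :: "complex poly \<Rightarrow> mat3 \<times> mat3 \<Rightarrow> mat3 \<times> mat3" where
  "mat_Psi q = (\<lambda>(X, Y). (X, Y + mat_poly q X))"

text \<open>
  An automorphism \<open>\<sigma>\<close> acts on \<open>(X, Y)\<close> by substituting \<open>(X, Y)\<close> into \<open>(\<sigma> x, \<sigma> y)\<close>. As \<open>X\<close> and \<open>Y\<close>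
  do not commute, this is to be read along a factorisation of \<open>\<sigma>\<close> into generators; the
  result does not depend on the factorisation. Substitution reverses products:
  \<open>(\<sigma> \<circ> aut_Phi p) x = \<sigma> x + p (\<sigma> y)\<close> and \<open>(\<sigma> \<circ> aut_Phi p) y = \<sigma> y\<close>, so \<open>\<sigma> \<circ> aut_Phi p\<close> acts
  by first applying \<open>\<sigma>\<close> and then \<open>mat_Phi p\<close>. No clause for inverses is needed, because the
  inverse of \<open>aut_Phi p\<close> is \<open>aut_Phi (- p)\<close>, and similarly for \<open>aut_Psi\<close>.
\<close>

inductive_set mat_action_graph ::
    "((cpoly2 \<Rightarrow> cpoly2) \<times> (mat3 \<times> mat3 \<Rightarrow> mat3 \<times> mat3)) set" where
  id: "(id, id) \<in> mat_action_graph"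
| Phi: "(\<sigma>, f) \<in> mat_action_graph \<Longrightarrow> (\<sigma> \<circ> aut_Phi p, mat_Phi p \<circ> f) \<in> mat_action_graph"
| Psi: "(\<sigma>, f) \<in> mat_action_graph \<Longrightarrow> (\<sigma> \<circ> aut_Psi q, mat_Psi q \<circ> f) \<in> mat_action_graph"

definition mat_action :: "(cpoly2 \<Rightarrow> cpoly2) \<Rightarrow> mat3 \<times> mat3 \<Rightarrow> mat3 \<times> mat3" where
  "mat_action \<sigma> = (THE f. (\<sigma>, f) \<in> mat_action_graph)"


section \<open>The quotient of pairs of matrices by simultaneous conjugation\<close>

text \<open>A point of \<open>\<complex>\<^sup>9\<close> is written \<open>(a1, \<dots>, a9)\<close>, a point of \<open>\<complex>\<^sup>1\<^sup>1\<close> is written \<open>(a1, \<dots>, a9, v, w)\<close>.\<close>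

type_synonym c7 =
  "complex \<times> complex \<times> complex \<times> complex \<times> complex \<times> complex \<times> complex"

type_synonym c9 = "complex \<times> complex \<times> c7"

type_synonym c11 =
  "complex \<times> complex \<times> complex \<times> complex \<times> complex \<times> complex \<times> complex \<times> complex \<times> complex \<times>
   complex \<times> complex"

definition invariants :: "mat3 \<times> mat3 \<Rightarrow> c11" where
  "invariants = (\<lambda>(X, Y).
     let A = X - mat (trace X / 3); B = Y - mat (trace Y / 3)
     in (trace X, trace Y,
         trace (A ** A), trace (A ** B), trace (B ** B),
         trace (A ** A ** A), trace (A ** A ** B), trace (A ** B ** B), trace (B ** B ** B),
         trace (A ** A ** B ** B) - trace (A ** B ** A ** B),
         trace (A ** A ** B ** B ** A ** B) - trace (A ** A ** B ** A ** B ** B)))"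

definition quotient_hypersurface :: "c11 set" where
  "quotient_hypersurface = {(a1, a2, a3, a4, a5, a6, a7, a8, a9, v, w).
     let r1 = a3 * a9 - 2 * a4 * a8 + a5 * a7;
         r2 = a3 * a8 - 2 * a4 * a7 + a5 * a6;
         r3 = a3 * (a3 * a5 - a4^2 - 3 * v) + 6 * (a6 * a8 - a7^2);
         r4 = a4 * (a3 * a5 - a4^2 - 3 * v) + 3 * (a6 * a9 - a7 * a8);
         r5 = a5 * (a3 * a5 - a4^2 - 3 * v) + 6 * (a7 * a9 - a8^2)
     in w^2 + 4 * v^3 / 27 - 1 / 27 * (r3 * r5 - r4^2)
          - 1 / 18 * (a3 * r1^2 - 2 * a4 * r1 * r2 + a5 * r2^2) = 0}"

text \<open>
  The class of \<open>(X, Y)\<close> in the quotient is identified with \<open>invariants (X, Y)\<close>. The value at \<open>P\<close> is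
  obtained from any pair of matrices over \<open>P\<close> and does not depend on the chosen pair.
\<close>

definition cremona_action :: "(cpoly2 \<Rightarrow> cpoly2) \<Rightarrow> c11 \<Rightarrow> c11" where
  "cremona_action \<sigma> = (\<lambda>P \<in> quotient_hypersurface.
     THE Q. \<exists>X Y. invariants (X, Y) = P \<and> invariants (mat_action \<sigma> (X, Y)) = Q)"


section \<open>The set \<open>\<complex>\<^sup>2 \<times> D3\<close>\<close>

definition D3 :: "c7 set" where
  "D3 = {(a3, a4, a5, a6, a7, a8, a9).
     a3 * a9 - 2 * a4 * a8 + a5 * a7 = 0 \<and>
     a5 * a6 - 2 * a4 * a7 + a3 * a8 = 0 \<and>
     9 * a3 - a3 * a4^2 + a3^2 * a5 + 6 * a6 * a8 - 6 * a7^2 = 0 \<and>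
     9 * a4 - a4^3 + a3 * a4 * a5 + 3 * a6 * a9 - 3 * a7 * a8 = 0 \<and>
     9 * a5 - a4^2 * a5 + a3 * a5^2 + 6 * a7 * a9 - 6 * a8^2 = 0}"

definition embed_c9 :: "c9 \<Rightarrow> c11" where
  "embed_c9 = (\<lambda>(a1, a2, a3, a4, a5, a6, a7, a8, a9). (a1, a2, a3, a4, a5, a6, a7, a8, a9, -3, 2))"

definition C2_times_D3 :: "c11 set" where
  "C2_times_D3 = embed_c9 ` (UNIV \<times> UNIV \<times> D3)"

end

(*
  Put D = B^2 - Tr(B^2)/3. By the Cayley-Hamilton theorem p(Y) = c0 + c1 B + c2 D with coefficients
  depending only on p and the invariants of Y, so Phi_p acts on the invariants of (X, Y) through an explicit
  polynomial map, the shear with parameters (c0, c1, c2), and every shear arises in this way. The five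
  defining relations of D3 are carried by a shear to combinations of themselves.

  For transitivity every point is moved by shears to a3 = a5 = ... = a9 = 0, a4 = 3. If A has distinct
  eigenvalues, i.e. a3^3 <> 6 a6^2, then a shear of Y attains a4 = 3, a7 = 0, and the relations force
  a5 = a8 = a9 = 0; a shear of X then finishes. The remaining points are moved by a shear into this case,
  up to exchanging X and Y. An explicit pair of matrices lies over the base point, so transporting it
  along shears shows that every point has a pair of matrices over it.

  That an automorphism of C[x, y] determines its action on matrices is the amalgamated product
  structure: a composite of elementary maps is either affine or has a reduced form, and along a suitable
  line of pairs of scalar matrices a reduced form has degree at least 2, so it is not the identity.
*)
theory Submission
  imports Defs
begin

section \<open>Traces of three by three matrices\<close>

definition smat :: "complex \<Rightarrow> mat3 \<Rightarrow> mat3" where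
  "smat c M = mat c ** M"

lemma smat_nth [simp]: "smat c M $ i $ j = c * M $ i $ j"
  by (simp add: smat_def matrix_matrix_mult_def mat_def if_distrib [where f = "\<lambda>x. x * _"] cong: if_cong)

lemma mat_eq_smat: "mat c = smat c (mat 1 :: mat3)"
  by (simp add: vec_eq_iff mat_def)

lemma smat_mat: "smat a (mat b) = mat (a * b)"
  by (simp add: vec_eq_iff mat_def)

lemma smat_smat: "smat a (smat b M) = smat (a * b) M"
  by (simp add: vec_eq_iff)

lemma smat_1 [simp]: "smat 1 M = M"
  by (simp add: smat_def)

lemma smat_0 [simp]: "smat 0 M = 0"
  by (simp add: vec_eq_iff)

lemma smat_add_right: "smat c (M + N) = smat c M + smat c N"
  by (simp add: vec_eq_iff algebra_simps)

lemma smat_diff_right: "smat c (M - N) = smat c M - smat c N"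
  by (simp add: vec_eq_iff algebra_simps)

lemma smat_zero_right [simp]: "smat c 0 = 0"
  by (simp add: vec_eq_iff)

lemma smat_add_left: "smat (a + b) M = smat a M + smat b M"
  by (simp add: vec_eq_iff algebra_simps)

lemma smat_minus_left: "smat (- a) M = - smat a M"
  by (simp add: vec_eq_iff)

lemma smat_mult_left: "smat c M ** N = smat c (M ** N)"
  by (simp add: smat_def matrix_mul_assoc)

lemma smat_mult_right: "M ** smat c N = smat c (M ** N)"
  by (simp add: vec_eq_iff matrix_matrix_mult_def sum_distrib_left algebra_simps)

lemma mult_mat_right: "M ** mat c = smat c M"
  using smat_mult_right [of M c "mat 1"] by (simp add: smat_mat)

lemma trace_smat: "trace (smat c M) = c * trace M"
  by (simp add: trace_def sum_distrib_left)

lemma matrix_diff_ldistrib: "(A :: mat3) ** (B - C) = A ** B - A ** C"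
  by (simp add: vec_eq_iff matrix_matrix_mult_def sum_subtractf algebra_simps)

lemma matrix_diff_rdistrib: "(A - B) ** (C :: mat3) = A ** C - B ** C"
  by (simp add: vec_eq_iff matrix_matrix_mult_def sum_subtractf algebra_simps)

lemma matrix_add_rdistrib: "(A + B) ** (C :: mat3) = A ** C + B ** C"
  by (simp add: vec_eq_iff matrix_matrix_mult_def sum.distrib algebra_simps)

lemma trace_mat: "trace (mat c :: mat3) = 3 * c"
  by (simp add: trace_def mat_def sum_3)

text \<open>Expands a trace into traces of right-nested words, the shape used in the trace
  identities below.\<close>

lemmas mat3_simps = matrix_add_ldistrib matrix_add_rdistrib matrix_diff_ldistrib matrix_diff_rdistrib
  smat_add_right smat_diff_right smat_mult_left smat_mult_right smat_smat trace_add trace_sub trace_smat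
  matrix_mul_assoc [symmetric]

text \<open>By Newton's identities for trace zero, the second elementary symmetric function of the
  eigenvalues is \<open>- trace (M ** M) / 2\<close> and the determinant is a third of the trace of
  the cube.\<close>

lemma cayley_hamilton_traceless:
  fixes M :: mat3
  assumes "trace M = 0"
  shows "M ** (M ** M) = smat (trace (M ** M) / 2) M + smat (trace (M ** (M ** M)) / 3) (mat 1)"
proof -
  have M33: "M $ 3 $ 3 = - M $ 1 $ 1 - M $ 2 $ 2"
    using assms by (simp add: trace_def sum_3 eq_neg_iff_add_eq_0 algebra_simps)
  show ?thesis
    by (simp add: vec_eq_iff forall_3 matrix_matrix_mult_def sum_3 trace_def mat_def M33 field_simps)
qed

text \<open>Cayley-Hamilton times \<open>M\<close>; the determinant term drops because
  \<open>trace M = 0\<close>.\<close>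

lemma trace_power4_traceless:
  fixes M :: mat3
  assumes "trace M = 0"
  shows "trace (M ** (M ** (M ** M))) = (trace (M ** M))\<^sup>2 / 2"
  by (subst cayley_hamilton_traceless [OF assms])
    (simp add: mat3_simps assms power2_eq_square)

section \<open>Polynomials evaluated at matrices\<close>

text \<open>The slack in the bound covers \<open>pCons a 0\<close>, whose degree is not one more
  than that of \<open>0\<close>.\<close>

lemma mat_poly_eq_sum:
  assumes "degree p \<le> n"
  shows "mat_poly p M = (\<Sum>k\<le>n. smat (coeff p k) (((**) M ^^ k) (mat 1)))"
proof -
  have "(\<Sum>k\<le>degree p. smat (coeff p k) (((**) M ^^ k) (mat 1))) = (\<Sum>k\<le>n. smat (coeff p k) (((**) M ^^ k) (mat 1)))"
    by (rule sum.mono_neutral_left) (use assms in \<open>auto simp: coeff_eq_0\<close>)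
  then show ?thesis
    by (simp add: mat_poly_def smat_def)
qed

lemma mat_poly_0 [simp]: "mat_poly 0 M = 0"
  by (simp add: mat_poly_def)

lemma mat_poly_pCons: "mat_poly (pCons a p) M = mat a + M ** mat_poly p M"
proof -
  have dist: "M ** (\<Sum>k\<in>S. f k) = (\<Sum>k\<in>S. M ** f k)" if "finite S" for f and S :: "nat set"
    using that by (induction S) (auto simp: matrix_add_ldistrib)
  have "mat_poly (pCons a p) M = (\<Sum>k\<le>Suc (degree p). smat (coeff (pCons a p) k) (((**) M ^^ k) (mat 1)))"
    by (rule mat_poly_eq_sum) (simp add: degree_pCons_le)
  also have "\<dots> = smat a (mat 1) + (\<Sum>k\<le>degree p. smat (coeff p k) (M ** ((**) M ^^ k) (mat 1)))"
    by (subst sum.atMost_Suc_shift) simp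
  also have "\<dots> = mat a + M ** mat_poly p M"
    by (simp add: mat_eq_smat [symmetric] mat_poly_eq_sum [OF order_refl] dist smat_mult_right)
  finally show ?thesis .
qed

lemma mat_add: "mat (a + b) = (mat a + mat b :: mat3)"
  by (simp add: vec_eq_iff mat_def)

lemma mat_minus: "mat (- a) = (- mat a :: mat3)"
  by (simp add: vec_eq_iff mat_def)

lemma mat_mult_mat: "mat a ** mat b = (mat (a * b) :: mat3)"
  by (simp add: smat_mat flip: smat_def)

lemma mat_eq_iff: "mat a = (mat b :: mat3) \<longleftrightarrow> a = b"
  by (auto simp: vec_eq_iff mat_def)

lemma mat_poly_add: "mat_poly (p + q) M = mat_poly p M + mat_poly q M"
  by (induction p q rule: poly_induct2)
    (simp_all add: mat_poly_pCons mat_add matrix_add_ldistrib)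

lemma mat_poly_smult: "mat_poly (smult c p) M = smat c (mat_poly p M)"
  by (induction p) (simp_all add: mat_poly_pCons smat_add_right smat_mult_right smat_mat)

lemma mat_poly_minus: "mat_poly (- p) M = - mat_poly p M"
  using mat_poly_smult [of "-1" p M] by (simp add: smat_minus_left)

lemma mat_poly_mult: "mat_poly (p * q) M = mat_poly p M ** mat_poly q M"
  by (induction p)
    (simp_all add: mat_poly_pCons mat_poly_add mat_poly_smult matrix_add_rdistrib smat_def
      matrix_mul_assoc)

lemma mat_poly_pcompose: "mat_poly (pcompose p q) M = mat_poly p (mat_poly q M)"
  by (induction p)
    (simp_all add: pcompose_pCons mat_poly_add mat_poly_mult mat_poly_pCons)

lemma mat_poly_mat: "mat_poly p (mat c) = mat (poly p c)"
  by (induction p) (simp_all add: mat_poly_pCons mat_mult_mat mat_add)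

section \<open>Shears\<close>

text \<open>The invariants of \<open>(X + c0 + c1 B + c2 D, Y)\<close> in terms of those of
  \<open>(X, Y)\<close>, where \<open>D\<close> is the traceless part of \<open>B ** B\<close>. With
  \<open>S = c1 B + c2 D\<close>, the numbers \<open>\<beta>\<close> and \<open>\<delta>\<close> are
  the coefficients of \<open>B\<close> and \<open>D\<close> in \<open>S ** S\<close>.\<close>

definition shear :: "complex \<Rightarrow> complex \<Rightarrow> complex \<Rightarrow> c11 \<Rightarrow> c11" where
  "shear c0 c1 c2 = (\<lambda>(a1, a2, a3, a4, a5, a6, a7, a8, a9, v, w).
     let \<beta> = c1 * c2 * a5 / 3 + c2\<^sup>2 * a9 / 3; \<delta> = c1\<^sup>2 - c2\<^sup>2 * a5 / 6
     in (a1 + 3 * c0, a2,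
         a3 + 2 * (c1 * a4 + c2 * a8) + c1\<^sup>2 * a5 + 2 * c1 * c2 * a9 + c2\<^sup>2 * a5\<^sup>2 / 6,
         a4 + c1 * a5 + c2 * a9,
         a5,
         a6 + 3 * (c1 * a7 + c2 * (a4\<^sup>2 / 3 - a3 * a5 / 6 + v / 3)) + 3 * (\<beta> * a4 + \<delta> * a8)
           + c1 * (\<beta> * a5 + \<delta> * a9) + c2 * (\<beta> * a9 + \<delta> * a5\<^sup>2 / 6),
         a7 + 2 * (c1 * a8 + c2 * a4 * a5 / 6) + \<beta> * a5 + \<delta> * a9,
         a8 + c1 * a9 + c2 * a5\<^sup>2 / 6,
         a9, v, w))"

text \<open>Multiplication table of the commutative algebra spanned by \<open>1\<close>,
  \<open>B\<close> and \<open>D\<close>, from Cayley-Hamilton for \<open>B\<close>.\<close>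

lemma traceless_square_mult:
  fixes B :: mat3
  assumes "trace B = 0" and "D = B ** B - mat (trace (B ** B) / 3)"
  shows "B ** D = smat (trace (B ** B) / 6) B + smat (trace (B ** (B ** B)) / 3) (mat 1)"
    and "D ** B = B ** D"
    and "D ** D = smat (- trace (B ** B) / 6) D + smat (trace (B ** (B ** B)) / 3) B
           + smat ((trace (B ** B))\<^sup>2 / 18) (mat 1)"
proof -
  define b5 b9 where "b5 = trace (B ** B)" and "b9 = trace (B ** (B ** B))"
  have D: "D = B ** B - smat (b5 / 3) (mat 1)"
    by (simp add: assms smat_mat b5_def)
  have CH: "B ** (B ** B) = smat (b5 / 2) B + smat (b9 / 3) (mat 1)"
    using cayley_hamilton_traceless [OF assms(1)] by (simp add: b5_def b9_def)
  have BD: "B ** D = smat (b5 / 6) B + smat (b9 / 3) (mat 1)"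
    by (simp add: D matrix_diff_ldistrib CH smat_mult_right) (simp add: vec_eq_iff field_simps)
  show "B ** D = smat (trace (B ** B) / 6) B + smat (trace (B ** (B ** B)) / 3) (mat 1)"
    using BD by (simp add: b5_def b9_def)
  show "D ** B = B ** D"
    by (simp add: D mat3_simps)
  have "D ** D = B ** (B ** D) - smat (b5 / 3) D"
    by (subst (1) D) (simp add: matrix_diff_rdistrib smat_mult_left matrix_mul_assoc)
  also have "\<dots> = smat (b5 / 6) (B ** B) + smat (b9 / 3) B - smat (b5 / 3) D"
    by (simp add: BD matrix_add_ldistrib smat_mult_right)
  also have "B ** B = D + smat (b5 / 3) (mat 1)"
    by (simp add: D)
  finally show "D ** D = smat (- trace (B ** B) / 6) D + smat (trace (B ** (B ** B)) / 3) B
           + smat ((trace (B ** B))\<^sup>2 / 18) (mat 1)"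
    by (simp add: vec_eq_iff flip: b5_def b9_def) (simp add: field_simps power2_eq_square)
qed

section \<open>Trace identities and the effect of a shear on the invariants\<close>

lemma trace_cyclic: "trace (M ** (N ** K)) = trace (N ** (K ** (M :: mat3)))"
  using trace_mul_sym [of M "N ** K"] by (simp add: matrix_mul_assoc)

lemma trace_cyclic4: "trace (M ** (N ** (K ** L))) = trace (N ** (K ** (L ** (M :: mat3))))"
  using trace_mul_sym [of M "N ** (K ** L)"] by (simp add: matrix_mul_assoc)

text \<open>Polarisation of \<open>trace_power4_traceless\<close>: adding its instances for
  \<open>A + B\<close> and \<open>A - B\<close> isolates the terms of degree two in each of
  \<open>A\<close> and \<open>B\<close>.\<close>

lemma trace_AABB:
  fixes A B :: mat3
  assumes "trace A = 0" and "trace B = 0"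
  shows "trace (A ** (A ** (B ** B))) = (trace (A ** A) * trace (B ** B) + 2 * (trace (A ** B))\<^sup>2
    + 2 * (trace (A ** (A ** (B ** B))) - trace (A ** (B ** (A ** B))))) / 6"
proof -
  have p: "trace (A + B) = 0" and m: "trace (A - B) = 0"
    using assms by (simp_all add: trace_add trace_sub)
  have BA: "trace (B ** A) = trace (A ** B)"
    by (rule trace_mul_sym)
  have c: "trace (A ** (B ** (B ** A))) = trace (A ** (A ** (B ** B)))"
    "trace (B ** (A ** (A ** B))) = trace (A ** (A ** (B ** B)))"
    "trace (B ** (B ** (A ** A))) = trace (A ** (A ** (B ** B)))"
    "trace (B ** (A ** (B ** A))) = trace (A ** (B ** (A ** B)))"
    "trace (A ** (A ** (B ** A))) = trace (A ** (A ** (A ** B)))"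
    "trace (A ** (B ** (A ** A))) = trace (A ** (A ** (A ** B)))"
    "trace (B ** (A ** (A ** A))) = trace (A ** (A ** (A ** B)))"
    "trace (B ** (A ** (B ** B))) = trace (A ** (B ** (B ** B)))"
    "trace (B ** (B ** (A ** B))) = trace (A ** (B ** (B ** B)))"
    "trace (B ** (B ** (B ** A))) = trace (A ** (B ** (B ** B)))"
    by (metis trace_cyclic4)+
  show ?thesis
    using trace_power4_traceless [OF p] trace_power4_traceless [OF m]
      trace_power4_traceless [OF assms(1)] trace_power4_traceless [OF assms(2)]
    by (simp add: mat3_simps BA c power2_eq_square) (simp add: field_simps, algebra)
qed

lemma invariants_eq:
  fixes X Y :: mat3
  defines "A \<equiv> X - mat (trace X / 3)" and "B \<equiv> Y - mat (trace Y / 3)"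
  shows "invariants (X, Y) = (trace X, trace Y, trace (A ** A), trace (A ** B), trace (B ** B),
    trace (A ** (A ** A)), trace (A ** (A ** B)), trace (A ** (B ** B)), trace (B ** (B ** B)),
    trace (A ** (A ** (B ** B))) - trace (A ** (B ** (A ** B))),
    trace (A ** (A ** (B ** (B ** (A ** B))))) - trace (A ** (A ** (B ** (A ** (B ** B))))))"
  by (simp add: invariants_def Let_def A_def B_def matrix_mul_assoc)

text \<open>Both expressions are invariant under \<open>A \<mapsto> A + S\<close> with \<open>S\<close> commuting with \<open>B\<close>.\<close>

lemma commutator_invariants:
  fixes A B :: mat3
  defines "C \<equiv> A ** B - B ** A"
  shows "trace (A ** (A ** (B ** B))) - trace (A ** (B ** (A ** B))) = - trace (C ** C) / 2"
    and "trace (A ** (A ** (B ** (B ** (A ** B))))) - trace (A ** (A ** (B ** (A ** (B ** B)))))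
      = trace (C ** (C ** C)) / 3"
proof -
  have c4: "trace (A ** (B ** (B ** A))) = trace (A ** (A ** (B ** B)))"
    "trace (B ** (A ** (A ** B))) = trace (A ** (A ** (B ** B)))"
    "trace (B ** (A ** (B ** A))) = trace (A ** (B ** (A ** B)))"
    by (metis trace_cyclic4)+
  show "trace (A ** (A ** (B ** B))) - trace (A ** (B ** (A ** B))) = - trace (C ** C) / 2"
    by (simp add: C_def mat3_simps c4)
  have r: "trace (M ** (N ** (K ** (L ** (P ** Q))))) = trace (N ** (K ** (L ** (P ** (Q ** M)))))"
    for M N K L P Q :: mat3
    using trace_mul_sym [of M "N ** (K ** (L ** (P ** Q)))"] by (simp add: matrix_mul_assoc)
  \<comment> \<open>In the cube of \<open>C\<close> the words with one factor \<open>B ** A\<close>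
    are rotations of one another, likewise those with two; the two alternating words cancel.\<close>
  have c6: "trace (A ** (B ** (A ** (B ** (B ** A))))) = trace (A ** (A ** (B ** (A ** (B ** B)))))"
    "trace (A ** (B ** (B ** (A ** (A ** B))))) = trace (A ** (A ** (B ** (A ** (B ** B)))))"
    "trace (B ** (A ** (A ** (B ** (A ** B))))) = trace (A ** (A ** (B ** (A ** (B ** B)))))"
    "trace (A ** (B ** (B ** (A ** (B ** A))))) = trace (A ** (A ** (B ** (B ** (A ** B)))))"
    "trace (B ** (A ** (A ** (B ** (B ** A))))) = trace (A ** (A ** (B ** (B ** (A ** B)))))"
    "trace (B ** (A ** (B ** (A ** (A ** B))))) = trace (A ** (A ** (B ** (B ** (A ** B)))))"
    "trace (B ** (A ** (B ** (A ** (B ** A))))) = trace (A ** (B ** (A ** (B ** (A ** B)))))"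
    by (metis r)+
  show "trace (A ** (A ** (B ** (B ** (A ** B))))) - trace (A ** (A ** (B ** (A ** (B ** B)))))
      = trace (C ** (C ** C)) / 3"
    by (simp add: C_def mat3_simps c6)
qed

text \<open>\<open>A\<close> becomes \<open>A + S\<close> with \<open>S\<close> a combination of
  \<open>B\<close> and \<open>D\<close>. As \<open>S\<close> commutes with \<open>B\<close>, the
  commutator is unchanged, hence so are \<open>v\<close> and \<open>w\<close>; the other traces
  follow from the multiplication table.\<close>

lemma invariants_shear:
  fixes X Y :: mat3
  assumes B: "B = Y - mat (trace Y / 3)" and D: "D = B ** B - mat (trace (B ** B) / 3)"
  shows "invariants (X + (mat c0 + smat c1 B + smat c2 D), Y) = shear c0 c1 c2 (invariants (X, Y))"
proof -
  define A where "A = X - mat (trace X / 3)"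
  define S where "S = smat c1 B + smat c2 D"
  define a3 a4 a5 a6 a7 a8 a9 where "a3 = trace (A ** A)" and "a4 = trace (A ** B)"
    and "a5 = trace (B ** B)" and "a6 = trace (A ** (A ** A))" and "a7 = trace (A ** (A ** B))"
    and "a8 = trace (A ** (B ** B))" and "a9 = trace (B ** (B ** B))"
  define v where "v = trace (A ** (A ** (B ** B))) - trace (A ** (B ** (A ** B)))"
  note defs = a3_def a4_def a5_def a6_def a7_def a8_def a9_def v_def
  have trA: "trace A = 0" and trB: "trace B = 0" and trD: "trace D = 0"
    by (simp_all add: A_def B D trace_sub trace_mat)
  have BB: "B ** B = D + smat (a5 / 3) (mat 1)"
    by (simp add: D smat_mat a5_def)
  have BD: "B ** D = smat (a5 / 6) B + smat (a9 / 3) (mat 1)"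
    using traceless_square_mult(1) [OF trB D] by (simp add: a5_def a9_def)
  have DB: "D ** B = smat (a5 / 6) B + smat (a9 / 3) (mat 1)"
    using traceless_square_mult(2) [OF trB D] BD by simp
  have DD: "D ** D = smat (- a5 / 6) D + smat (a9 / 3) B + smat (a5\<^sup>2 / 18) (mat 1)"
    using traceless_square_mult(3) [OF trB D] by (simp add: a5_def a9_def)
  have assoc: "M ** (N ** K) = (M ** N) ** K" for M N K :: mat3
    by (rule matrix_mul_assoc)
  have red: "B ** (B ** M) = (D + smat (a5 / 3) (mat 1)) ** M"
    "B ** (D ** M) = (smat (a5 / 6) B + smat (a9 / 3) (mat 1)) ** M"
    "D ** (B ** M) = (smat (a5 / 6) B + smat (a9 / 3) (mat 1)) ** M"
    "D ** (D ** M) = (smat (- a5 / 6) D + smat (a9 / 3) B + smat (a5\<^sup>2 / 18) (mat 1)) ** M" for M :: mat3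
    by (simp_all only: assoc BB BD DB DD)
  have t1: "trace (A ** A) = a3" "trace (A ** B) = a4" "trace (B ** A) = a4"
    "trace (A ** (A ** A)) = a6" "trace (A ** (A ** B)) = a7" "trace (A ** (B ** A)) = a7"
    "trace (B ** (A ** A)) = a7"
    unfolding defs by (simp_all add: trace_mul_sym [of B A] trace_cyclic [of B] trace_cyclic [of A B A])
  have AD: "trace (A ** D) = a8"
    by (simp add: D a8_def matrix_diff_ldistrib mult_mat_right trace_sub trace_smat trA)
  \<comment> \<open>\<open>trace_AABB\<close> brings this quartic trace back to the coordinates;
    here \<open>v\<close> enters.\<close>
  have AAD: "trace (A ** (A ** D)) = a4\<^sup>2 / 3 - a3 * a5 / 6 + v / 3"
  proof -
    have e: "trace (A ** (A ** (B ** B))) = (a3 * a5 + 2 * a4\<^sup>2 + 2 * v) / 6"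
      unfolding defs by (rule trace_AABB [OF trA trB])
    have f: "trace (A ** (A ** D)) = trace (A ** (A ** (B ** B))) - a5 * a3 / 3"
      by (simp add: BB mat3_simps a3_def)
    show ?thesis
      unfolding f e by (simp add: field_simps)
  qed
  have t2: "trace (D ** A) = a8" "trace (A ** (D ** A)) = a4\<^sup>2 / 3 - a3 * a5 / 6 + v / 3"
     "trace (D ** (A ** A)) = a4\<^sup>2 / 3 - a3 * a5 / 6 + v / 3"
    by (simp_all add: trace_mul_sym [of D A] trace_cyclic [of D] trace_cyclic [of A D A] AD AAD)
  have t3: "trace (B ** (A ** M)) = trace (A ** (M ** B))" "trace (D ** (A ** M)) = trace (A ** (M ** D))" for M
    by (rule trace_cyclic)+
  have trX': "trace (X + (mat c0 + smat c1 B + smat c2 D)) = trace X + 3 * c0"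
    by (simp add: trace_add trace_mat trace_smat trB trD)
  have A': "X + (mat c0 + smat c1 B + smat c2 D) - mat ((trace X + 3 * c0) / 3) = A + S"
    by (simp add: A_def S_def vec_eq_iff mat_def add_divide_distrib)
  have comm: "(A + S) ** B - B ** (A + S) = A ** B - B ** A"
    by (simp add: S_def mat3_simps BB BD DB)
  have one: "trace (mat 1 :: mat3) = 3"
    by (simp add: trace_mat)
  note simps = S_def mat3_simps BB BD DB DD red t1 AD AAD t2 t3 trA trB trD one
  have 3: "trace ((A + S) ** (A + S)) = a3 + 2 * (c1 * a4 + c2 * a8) + c1\<^sup>2 * a5 + 2 * c1 * c2 * a9 + c2\<^sup>2 * a5\<^sup>2 / 6"
    by (simp add: simps) (simp add: field_simps power2_eq_square)
  have 4: "trace ((A + S) ** B) = a4 + c1 * a5 + c2 * a9"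
    by (simp add: simps)
  have 8: "trace ((A + S) ** (B ** B)) = a8 + c1 * a9 + c2 * a5\<^sup>2 / 6"
    by (simp add: simps)
  let ?\<beta> = "c1 * c2 * a5 / 3 + c2\<^sup>2 * a9 / 3" and ?\<delta> = "c1\<^sup>2 - c2\<^sup>2 * a5 / 6"
  have 7: "trace ((A + S) ** ((A + S) ** B)) = a7 + 2 * (c1 * a8 + c2 * a4 * a5 / 6) + ?\<beta> * a5 + ?\<delta> * a9"
    by (simp add: simps) (simp add: field_simps power2_eq_square)
  have 6: "trace ((A + S) ** ((A + S) ** (A + S))) = a6 + 3 * (c1 * a7 + c2 * (a4\<^sup>2 / 3 - a3 * a5 / 6 + v / 3))
      + 3 * (?\<beta> * a4 + ?\<delta> * a8) + c1 * (?\<beta> * a5 + ?\<delta> * a9) + c2 * (?\<beta> * a9 + ?\<delta> * a5\<^sup>2 / 6)"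
    by (simp only: simps matrix_mul_lid matrix_mul_rid) (simp add: field_simps power2_eq_square)
  show ?thesis
    unfolding invariants_eq trX' A' B [symmetric] A_def [symmetric] commutator_invariants comm 3 4 6 7 8
    by (simp add: shear_def Let_def commutator_invariants v_def flip: a3_def a4_def a5_def a6_def a7_def a8_def a9_def)
qed

lemma mat_poly_diff: "mat_poly (p - q) M = mat_poly p M - mat_poly q M"
  using mat_poly_add [of p "- q" M] by (simp add: mat_poly_minus)

lemma prod_cases11:
  obtains a1 a2 a3 a4 a5 a6 a7 a8 a9 v w where "P = (a1, a2, a3, a4, a5, a6, a7, a8, a9, v, w)"
  by (cases P) auto

text \<open>The quantifier order matters: the coefficients depend only on \<open>p\<close>,
  \<open>a2\<close>, \<open>a5\<close> and \<open>a9\<close>, so a single shear serves all pairs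
  with the same invariants.\<close>

lemma mat_poly_traceless_coeffs:
  "\<exists>c0 c1 c2. \<forall>Y B D. B = Y - mat (a2 / 3) \<and> D = B ** B - mat (a5 / 3) \<and> trace Y = a2 \<and>
     trace (B ** B) = a5 \<and> trace (B ** (B ** B)) = a9
     \<longrightarrow> mat_poly p Y = mat c0 + smat c1 B + smat c2 D"
proof (induction p)
  case 0
  show ?case
    by (rule exI [of _ 0])+ simp
next
  case (pCons a p)
  then obtain c0 c1 c2 where IH: "\<And>Y B D. B = Y - mat (a2 / 3) \<Longrightarrow> D = B ** B - mat (a5 / 3) \<Longrightarrow>
      trace Y = a2 \<Longrightarrow> trace (B ** B) = a5 \<Longrightarrow> trace (B ** (B ** B)) = a9
      \<Longrightarrow> mat_poly p Y = mat c0 + smat c1 B + smat c2 D"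
    by blast
  \<comment> \<open>Coefficients of \<open>a + Y ** (c0 + c1 B + c2 D)\<close> with
    \<open>Y = B + a2 / 3\<close>, reduced by the multiplication table.\<close>
  have "mat_poly (pCons a p) Y = mat (a + a2 / 3 * c0 + c1 * a5 / 3 + c2 * a9 / 3)
      + smat (a2 / 3 * c1 + c0 + c2 * a5 / 6) B + smat (a2 / 3 * c2 + c1) D"
    if h: "B = Y - mat (a2 / 3)" "D = B ** B - mat (a5 / 3)" "trace Y = a2"
      "trace (B ** B) = a5" "trace (B ** (B ** B)) = a9" for Y B D
  proof -
    have Y: "Y = B + smat (a2 / 3) (mat 1)"
      by (simp add: h smat_mat)
    have "trace B = 0"
      by (simp add: h(1,3) trace_sub trace_mat)
    then have BD: "B ** D = smat (a5 / 6) B + smat (a9 / 3) (mat 1)"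
      using traceless_square_mult(1) [of B D] h by simp
    have BB: "B ** B = D + smat (a5 / 3) (mat 1)"
      by (simp add: h smat_mat)
    have "mat_poly (pCons a p) Y = smat a (mat 1) + Y ** (smat c0 (mat 1) + smat c1 B + smat c2 D)"
      by (simp add: mat_poly_pCons IH [OF h] smat_mat)
    also have "\<dots> = smat (a + a2 / 3 * c0 + c1 * a5 / 3 + c2 * a9 / 3) (mat 1)
      + smat (a2 / 3 * c1 + c0 + c2 * a5 / 6) B + smat (a2 / 3 * c2 + c1) D"
      by (simp add: Y mat3_simps BB BD) (simp add: vec_eq_iff algebra_simps)
    finally show ?thesis
      by (simp add: smat_mat)
  qed
  then show ?case
    by blast
qed

lemma invariants_mat_Phi:
  "\<exists>c0 c1 c2. \<forall>X Y. invariants (X, Y) = P \<longrightarrow> invariants (mat_Phi p (X, Y)) = shear c0 c1 c2 P"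
proof -
  obtain a1 a2 a3 a4 a5 a6 a7 a8 a9 v w where P: "P = (a1, a2, a3, a4, a5, a6, a7, a8, a9, v, w)"
    using prod_cases11 by blast
  obtain c0 c1 c2 where c: "\<And>Y B D. B = Y - mat (a2 / 3) \<Longrightarrow> D = B ** B - mat (a5 / 3) \<Longrightarrow>
      trace Y = a2 \<Longrightarrow> trace (B ** B) = a5 \<Longrightarrow> trace (B ** (B ** B)) = a9
      \<Longrightarrow> mat_poly p Y = mat c0 + smat c1 B + smat c2 D"
    using mat_poly_traceless_coeffs [of a2 a5 a9 p] by blast
  have "invariants (mat_Phi p (X, Y)) = shear c0 c1 c2 P" if h: "invariants (X, Y) = P" for X Y
  proof -
    define B where "B = Y - mat (trace Y / 3)"
    define D where "D = B ** B - mat (trace (B ** B) / 3)"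
    have "trace Y = a2" "trace (B ** B) = a5" "trace (B ** (B ** B)) = a9"
      using h by (auto simp: invariants_eq P B_def)
    then have "mat_poly p Y = mat c0 + smat c1 B + smat c2 D"
      by (intro c) (simp_all add: B_def D_def)
    then show ?thesis
      using invariants_shear [OF B_def D_def, of X c0 c1 c2] by (simp add: mat_Phi_def h)
  qed
  then show ?thesis
    by blast
qed

text \<open>The polynomial may vary with the point, since subtracting the traces of \<open>Y\<close>
  and \<open>B ** B\<close> uses \<open>a2\<close> and \<open>a5\<close>.\<close>

lemma shear_mat_Phi:
  "\<exists>p. \<forall>X Y. invariants (X, Y) = P \<longrightarrow> invariants (mat_Phi p (X, Y)) = shear c0 c1 c2 P"
proof -
  obtain a1 a2 a3 a4 a5 a6 a7 a8 a9 v w where P: "P = (a1, a2, a3, a4, a5, a6, a7, a8, a9, v, w)"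
    using prod_cases11 by blast
  \<comment> \<open>\<open>q\<close> takes the value \<open>B\<close> at \<open>Y\<close>, so
    \<open>q * q - a5 / 3\<close> takes the value \<open>D\<close>.\<close>
  define q where "q = [:- a2 / 3, 1:]"
  define p where "p = [:c0:] + smult c1 q + smult c2 (q * q - [:a5 / 3:])"
  have "invariants (mat_Phi p (X, Y)) = shear c0 c1 c2 P" if h: "invariants (X, Y) = P" for X Y
  proof -
    define B where "B = Y - mat (trace Y / 3)"
    define D where "D = B ** B - mat (trace (B ** B) / 3)"
    have "trace Y = a2" "trace (B ** B) = a5"
      using h by (auto simp: invariants_eq P B_def)
    moreover from this have q: "mat_poly q Y = B"
      by (simp add: q_def B_def mat_poly_pCons mat_minus)
    ultimately have "mat_poly p Y = mat c0 + smat c1 B + smat c2 D"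
      by (simp add: p_def D_def mat_poly_add mat_poly_smult mat_poly_mult mat_poly_diff mat_poly_pCons q del: mult_pCons_left)
    then show ?thesis
      using invariants_shear [OF B_def D_def, of X c0 c1 c2] by (simp add: mat_Phi_def h)
  qed
  then show ?thesis
    by blast
qed

section \<open>The relations of \<open>D3\<close> under shears and under exchange of
  \<open>X\<close> and \<open>Y\<close>\<close>

definition swap11 :: "c11 \<Rightarrow> c11" where
  "swap11 = (\<lambda>(a1, a2, a3, a4, a5, a6, a7, a8, a9, v, w). (a2, a1, a5, a4, a3, a9, a8, a7, a6, v, - w))"

text \<open>The parameter \<open>w\<close> is needed because exchanging \<open>X\<close> and \<open>Y\<close> changes its sign.\<close>

definition D3_points :: "complex \<Rightarrow> c11 set" where
  "D3_points w = {(a1, a2, a3, a4, a5, a6, a7, a8, a9, v, w').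
     v = - 3 \<and> w' = w \<and> (a3, a4, a5, a6, a7, a8, a9) \<in> D3}"

lemma D3_iff: "(a3, a4, a5, a6, a7, a8, a9) \<in> D3 \<longleftrightarrow>
   a3 * a9 - 2 * a4 * a8 + a5 * a7 = 0 \<and>
   a5 * a6 - 2 * a4 * a7 + a3 * a8 = 0 \<and>
   9 * a3 - a3 * a4^2 + a3^2 * a5 + 6 * a6 * a8 - 6 * a7^2 = 0 \<and>
   9 * a4 - a4^3 + a3 * a4 * a5 + 3 * a6 * a9 - 3 * a7 * a8 = 0 \<and>
   9 * a5 - a4^2 * a5 + a3 * a5^2 + 6 * a7 * a9 - 6 * a8^2 = 0"
  by (simp add: D3_def)

lemma D3_points_iff: "(a1, a2, a3, a4, a5, a6, a7, a8, a9, v, w') \<in> D3_points w \<longleftrightarrow>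
   v = - 3 \<and> w' = w \<and> (a3, a4, a5, a6, a7, a8, a9) \<in> D3"
  by (simp add: D3_points_def)

lemma C2_times_D3_eq: "C2_times_D3 = D3_points 2"
proof (rule subset_antisym; rule subsetI)
  fix P assume "P \<in> D3_points 2"
  then show "P \<in> C2_times_D3"
    by (cases P rule: prod_cases11)
      (force simp: C2_times_D3_def embed_c9_def D3_points_def image_iff)
qed (auto simp: C2_times_D3_def embed_c9_def D3_points_def)

lemma swap11_swap11 [simp]: "swap11 (swap11 P) = P"
  by (cases P rule: prod_cases11) (simp add: swap11_def)

lemma swap11_in_D3_points: "P \<in> D3_points w \<Longrightarrow> swap11 P \<in> D3_points (- w)"
  by (cases P rule: prod_cases11) (simp add: swap11_def D3_points_iff D3_iff algebra_simps)

text \<open>The parameter \<open>6 * k\<close> clears all denominators, so that \<open>algebra\<close> applies.\<close>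

lemma shear_six: "shear c0 c1 (6 * k) (a1, a2, a3, a4, a5, a6, a7, a8, a9, v, w) =
  (a1 + 3 * c0, a2,
   a3 + 2 * c1 * a4 + 12 * k * a8 + c1^2 * a5 + 12 * c1 * k * a9 + 6 * k^2 * a5^2,
   a4 + c1 * a5 + 6 * k * a9,
   a5,
   a6 + 3 * c1 * a7 + 3 * k * (2 * a4^2 - a3 * a5 + 2 * v)
     + 3 * ((2 * c1 * k * a5 + 12 * k^2 * a9) * a4 + (c1^2 - 6 * k^2 * a5) * a8)
     + c1 * ((2 * c1 * k * a5 + 12 * k^2 * a9) * a5 + (c1^2 - 6 * k^2 * a5) * a9)
     + k * (6 * (2 * c1 * k * a5 + 12 * k^2 * a9) * a9 + (c1^2 - 6 * k^2 * a5) * a5^2),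
   a7 + 2 * c1 * a8 + 2 * k * a4 * a5 + (2 * c1 * k * a5 + 12 * k^2 * a9) * a5 + (c1^2 - 6 * k^2 * a5) * a9,
   a8 + c1 * a9 + k * a5^2,
   a9, v, w)"
  by (simp add: shear_def Let_def power2_eq_square) (simp add: field_simps)

text \<open>The five left-hand sides go over into polynomial combinations of themselves, displayed
  in the proof in terms of \<open>r1\<close> to \<open>r5\<close>.\<close>

lemma shear_in_D3_points:
  assumes "P \<in> D3_points w"
  shows "shear c0 c1 c2 P \<in> D3_points w"
proof -
  obtain k where k: "c2 = 6 * k"
    by (metis dvd_def dvd_field_iff zero_neq_numeral)
  obtain a1 a2 a3 a4 a5 a6 a7 a8 a9 v w' where P: "P = (a1, a2, a3, a4, a5, a6, a7, a8, a9, v, w')"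
    using prod_cases11 by blast
  define b3 where "b3 = a3 + 2 * c1 * a4 + 12 * k * a8 + c1^2 * a5 + 12 * c1 * k * a9 + 6 * k^2 * a5^2"
  define b4 where "b4 = a4 + c1 * a5 + 6 * k * a9"
  \<comment> \<open>The value \<open>v = - 3\<close> is already inserted, to match the constants 9
    in the relations, which are \<open>- 3 * v\<close>.\<close>
  define b6 where "b6 = a6 + 3 * c1 * a7 + 3 * k * (2 * a4^2 - a3 * a5 + 2 * (- 3))
     + 3 * ((2 * c1 * k * a5 + 12 * k^2 * a9) * a4 + (c1^2 - 6 * k^2 * a5) * a8)
     + c1 * ((2 * c1 * k * a5 + 12 * k^2 * a9) * a5 + (c1^2 - 6 * k^2 * a5) * a9)
     + k * (6 * (2 * c1 * k * a5 + 12 * k^2 * a9) * a9 + (c1^2 - 6 * k^2 * a5) * a5^2)"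
  define b7 where "b7 = a7 + 2 * c1 * a8 + 2 * k * a4 * a5 + (2 * c1 * k * a5 + 12 * k^2 * a9) * a5 + (c1^2 - 6 * k^2 * a5) * a9"
  define b8 where "b8 = a8 + c1 * a9 + k * a5^2"
  note bs = b3_def b4_def b6_def b7_def b8_def
  define r1 r2 r3 r4 r5 where "r1 = a3 * a9 - 2 * a4 * a8 + a5 * a7"
    and "r2 = a5 * a6 - 2 * a4 * a7 + a3 * a8"
    and "r3 = 9 * a3 - a3 * a4^2 + a3^2 * a5 + 6 * a6 * a8 - 6 * a7^2"
    and "r4 = 9 * a4 - a4^3 + a3 * a4 * a5 + 3 * a6 * a9 - 3 * a7 * a8"
    and "r5 = 9 * a5 - a4^2 * a5 + a3 * a5^2 + 6 * a7 * a9 - 6 * a8^2"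
  note rs = r1_def r2_def r3_def r4_def r5_def
  have v: "v = - 3" "w' = w" and r0: "r1 = 0" "r2 = 0" "r3 = 0" "r4 = 0" "r5 = 0"
    using assms by (simp_all add: P D3_points_iff D3_iff rs)
  have "b3 * a9 - 2 * b4 * b8 + a5 * b7 = r1"
    unfolding bs rs by algebra
  moreover have "a5 * b6 - 2 * b4 * b7 + b3 * b8 = r2 + c1 * r1 - 2 * k * r5"
    unfolding bs rs by algebra
  moreover have "9 * b3 - b3 * b4^2 + b3^2 * a5 + 6 * b6 * b8 - 6 * b7^2
      = r3 + 2 * c1 * r4 + c1^2 * r5 + 6 * k * a5 * r2 - 12 * k * a4 * r1 - 6 * c1 * k * a5 * r1
        - 6 * k^2 * a5 * r5 - 36 * k^2 * a9 * r1"
    unfolding bs rs by algebra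
  moreover have "9 * b4 - b4^3 + b3 * b4 * a5 + 3 * b6 * a9 - 3 * b7 * b8 = r4 + c1 * r5 - 3 * k * a5 * r1"
    unfolding bs rs by algebra
  moreover have "9 * a5 - b4^2 * a5 + b3 * a5^2 + 6 * b7 * a9 - 6 * b8^2 = r5"
    unfolding bs rs by algebra
  moreover have "shear c0 c1 c2 P = (a1 + 3 * c0, a2, b3, b4, a5, b6, b7, b8, a9, - 3, w)"
    by (simp only: k P shear_six v bs)
  ultimately show ?thesis
    by (simp add: D3_points_iff D3_iff r0)
qed

section \<open>Transitivity of the shears\<close>

text \<open>A shear of \<open>X\<close>, or one of \<open>Y\<close> obtained by conjugating with the
  exchange. The parameters may depend on the point.\<close>

definition shear_step :: "c11 \<Rightarrow> c11 \<Rightarrow> bool" where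
  "shear_step P Q \<longleftrightarrow>
     (\<exists>c0 c1 c2. Q = shear c0 c1 c2 P \<or> Q = swap11 (shear c0 c1 c2 (swap11 P)))"

text \<open>A shear changes neither \<open>B\<close> nor \<open>D\<close>, so the parameters of
  successive shears add up. On coordinates this is checked by expansion.\<close>

lemma shear_minus: "shear (- c0) (- c1) (- c2) (shear c0 c1 c2 P) = P"
proof -
  obtain k where k: "c2 = 6 * k"
    by (metis dvd_def dvd_field_iff zero_neq_numeral)
  have k': "- (6 * k) = 6 * (- k)"
    by simp
  obtain a1 a2 a3 a4 a5 a6 a7 a8 a9 v w where P: "P = (a1, a2, a3, a4, a5, a6, a7, a8, a9, v, w)"
    using prod_cases11 by blast
  show ?thesis
    unfolding k P k' shear_six prod.inject
    by (intro conjI; (rule refl | (simp add: algebra_simps power2_eq_square; fail) | algebra))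
qed

lemma shear_step_sym: "shear_step P Q \<Longrightarrow> shear_step Q P"
  unfolding shear_step_def by (metis shear_minus swap11_swap11)

lemma shear_steps_sym: "shear_step\<^sup>*\<^sup>* P Q \<Longrightarrow> shear_step\<^sup>*\<^sup>* Q P"
  by (induction rule: rtranclp_induct) (auto intro: converse_rtranclp_into_rtranclp shear_step_sym)

lemma shear_step_swap11: "shear_step P Q \<Longrightarrow> shear_step (swap11 P) (swap11 Q)"
  unfolding shear_step_def by (metis swap11_swap11)

lemma shear_steps_swap11: "shear_step\<^sup>*\<^sup>* P Q \<Longrightarrow> shear_step\<^sup>*\<^sup>* (swap11 P) (swap11 Q)"
  by (induction rule: rtranclp_induct) (auto intro: rtranclp.rtrancl_into_rtrancl shear_step_swap11)

lemma shear_step_in_D3_points: "shear_step P Q \<Longrightarrow> P \<in> D3_points w \<Longrightarrow> Q \<in> D3_points w"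
  unfolding shear_step_def
  using shear_in_D3_points [of P w]
    swap11_in_D3_points [OF shear_in_D3_points [OF swap11_in_D3_points [of P w]]]
  by auto

text \<open>With all of \<open>a3\<close> to \<open>a9\<close> zero except \<open>a4\<close>, the
  relations reduce to \<open>9 * a4 = a4^3\<close>; the root 3 is taken.\<close>

definition base_point :: "complex \<Rightarrow> c11" where
  "base_point w = (0, 0, 0, 3, 0, 0, 0, 0, 0, - 3, w)"

lemma swap11_base_point: "swap11 (base_point w) = base_point (- w)"
  by (simp add: swap11_def base_point_def)

text \<open>\<open>w\<close> is existential because the exchange replaces it by
  \<open>- w\<close>.\<close>

definition reaches_base :: "c11 \<Rightarrow> bool" where
  "reaches_base P \<longleftrightarrow> (\<exists>w. shear_step\<^sup>*\<^sup>* P (base_point w))"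

lemma reaches_base_swap11: "reaches_base (swap11 P) \<Longrightarrow> reaches_base P"
  unfolding reaches_base_def by (metis shear_steps_swap11 swap11_base_point swap11_swap11)

lemma reaches_base_shear: "reaches_base (shear c0 c1 c2 P) \<Longrightarrow> reaches_base P"
  unfolding reaches_base_def by (metis converse_rtranclp_into_rtranclp shear_step_def)

lemma reaches_base_swap_shear: "reaches_base (shear c0 c1 c2 (swap11 P)) \<Longrightarrow> reaches_base P"
  using reaches_base_shear reaches_base_swap11 by blast

text \<open>Up to a constant factor, \<open>a3^3 - 6 * a6^2\<close> is the discriminant of the characteristic polynomial of \<open>A\<close>.\<close>

lemma reaches_base_discriminant:
  assumes P: "(a1, a2, a3, a4, a5, a6, a7, a8, a9, v, w') \<in> D3_points w"
    and disc: "a3^3 \<noteq> 6 * a6^2"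
  shows "reaches_base (a1, a2, a3, a4, a5, a6, a7, a8, a9, v, w')"
proof -
  define d where "d = a3^3 - 6 * a6^2"
  have d: "d \<noteq> 0"
    using disc by (simp add: d_def)
  \<comment> \<open>Cramer's rule for the linear system stated next, whose determinant is
    \<open>d / 6\<close>.\<close>
  define q1 q2 where "q1 = ((3 - a4) * a3^2 + 6 * a7 * a6) / d" and "q2 = - 6 * (a3 * a7 + a6 * (3 - a4)) / d"
  have q: "a4 + q1 * a3 + q2 * a6 = 3" "a7 + q1 * a6 + q2 * a3^2 / 6 = 0"
    unfolding q1_def q2_def using d by (simp_all add: field_simps) (simp_all add: d_def algebra_simps power2_eq_square power3_eq_cube)
  \<comment> \<open>A shear of \<open>Y\<close> along \<open>A\<close> that makes the trace of
    \<open>Y\<close> zero, \<open>a4 = 3\<close> and \<open>a7 = 0\<close>.\<close>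
  obtain b5 b8 b9 where Q: "shear (- a2 / 3) q1 q2 (swap11 (a1, a2, a3, a4, a5, a6, a7, a8, a9, v, w'))
      = swap11 (a1, 0, a3, 3, b5, a6, 0, b8, b9, v, w')"
    using q by (simp add: swap11_def shear_def Let_def)
  have "swap11 (a1, 0, a3, 3, b5, a6, 0, b8, b9, v, w') \<in> D3_points (- w)"
    unfolding Q [symmetric] by (intro shear_in_D3_points swap11_in_D3_points P)
  from swap11_in_D3_points [OF this] have mem: "(a1, 0, a3, 3, b5, a6, 0, b8, b9, v, w') \<in> D3_points w"
    by simp
  then have v: "v = - 3" "w' = w" and e: "a3 * b9 - 6 * b8 = 0" "b5 * a6 + a3 * b8 = 0" "a3^2 * b5 + 6 * a6 * b8 = 0"
    "a3 * 3 * b5 + 3 * a6 * b9 = 0"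
    by (simp_all add: D3_points_iff D3_iff power2_eq_square power3_eq_cube)
  \<comment> \<open>Elimination of \<open>b8\<close> between the second and third relations in
    \<open>e\<close>.\<close>
  have "d * b5 = 0"
    unfolding d_def using e by algebra
  with d have b5: "b5 = 0"
    by simp
  have nz: "a3 \<noteq> 0 \<or> a6 \<noteq> 0"
    using disc by auto
  with e b5 have b8: "b8 = 0"
    by auto
  with e b5 nz have b9: "b9 = 0"
    by auto
  \<comment> \<open>With \<open>a5\<close>, \<open>a7\<close>, \<open>a8\<close>, \<open>a9\<close>
    zero and \<open>a4 = 3\<close>, a shear only adds \<open>3 * c0\<close>, \<open>6 * c1\<close>,
    \<open>6 * c2\<close> to \<open>a1\<close>, \<open>a3\<close>, \<open>a6\<close>.\<close>
  have "shear (- a1 / 3) (- a3 / 6) (- a6 / 6) (a1, 0, a3, 3, b5, a6, 0, b8, b9, v, w') = base_point w"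
    by (simp add: shear_def Let_def b5 b8 b9 v base_point_def)
  then have "reaches_base (shear (- a1 / 3) (- a3 / 6) (- a6 / 6) (a1, 0, a3, 3, b5, a6, 0, b8, b9, v, w'))"
    unfolding reaches_base_def by (metis rtranclp.rtrancl_refl)
  then have "reaches_base (a1, 0, a3, 3, b5, a6, 0, b8, b9, v, w')"
    by (rule reaches_base_shear)
  then show ?thesis
    using Q reaches_base_swap_shear reaches_base_swap11 by (metis swap11_swap11)
qed

text \<open>If \<open>a9 \<noteq> 0\<close>, the discriminant of \<open>B\<close> is nonzero and the
  previous lemma applies after the exchange. Otherwise a shear along \<open>D\<close> changes
  \<open>a6\<close> and keeps \<open>a3\<close>, so the discriminant of \<open>A\<close> can be made
  nonzero.\<close>

lemma reaches_base_a5_zero: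
  assumes P: "(a1, a2, a3, a4, 0, a6, a7, a8, a9, v, w') \<in> D3_points w"
  shows "reaches_base (a1, a2, a3, a4, 0, a6, a7, a8, a9, v, w')"
proof (cases "a9 = 0")
  case False
  have "swap11 (a1, a2, a3, a4, 0, a6, a7, a8, a9, v, w') \<in> D3_points (- w)"
    by (rule swap11_in_D3_points [OF P])
  then have "reaches_base (swap11 (a1, a2, a3, a4, 0, a6, a7, a8, a9, v, w'))"
    unfolding swap11_def using False by (simp add: reaches_base_discriminant)
  then show ?thesis
    by (rule reaches_base_swap11)
next
  case True
  have v: "v = - 3" and a8: "a8 = 0" and e: "9 * a4 = a4^3"
    using P True by (auto simp: D3_points_iff D3_iff)
  have a4: "a4^2 \<noteq> 3"
  proof
    assume 3: "a4^2 = 3"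
    then have "9 * a4 = 3 * a4"
      using e by (simp add: power3_eq_cube power2_eq_square)
    then have "a4 = 0"
      by simp
    with 3 show False
      by simp
  qed
  \<comment> \<open>\<open>3 * s\<close> is the rate at which \<open>a6\<close> changes with
    \<open>k\<close>; it is nonzero because \<open>a4\<close> is 0, 3 or -3.\<close>
  define s where "s = 2 * (a4^2 - 3)"
  have "s \<noteq> 0"
    using a4 by (simp add: s_def)
  have sh: "shear 0 0 (6 * k) (a1, a2, a3, a4, 0, a6, a7, a8, a9, v, w') =
    (a1, a2, a3, a4, 0, a6 + 3 * k * s, a7, 0, 0, v, w')" for k
    unfolding shear_six by (simp add: True a8 v s_def algebra_simps)
  \<comment> \<open>The new \<open>a6\<close> is made 1 when \<open>a3 = 0\<close> and 0
    otherwise.\<close>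
  obtain k where k: "a3^3 \<noteq> 6 * (a6 + 3 * k * s)^2"
  proof (cases "a3 = 0")
    case True
    have "6 * (a6 + 3 * ((1 - a6) / (3 * s)) * s)^2 = 6"
      using \<open>s \<noteq> 0\<close> by (simp add: field_simps)
    with True show ?thesis
      by (intro that [of "(1 - a6) / (3 * s)"]) auto
  next
    case False
    have "6 * (a6 + 3 * (- a6 / (3 * s)) * s)^2 = 0"
      using \<open>s \<noteq> 0\<close> by simp
    with False show ?thesis
      by (intro that [of "- a6 / (3 * s)"]) auto
  qed
  have "shear 0 0 (6 * k) (a1, a2, a3, a4, 0, a6, a7, a8, a9, v, w') \<in> D3_points w"
    by (rule shear_in_D3_points [OF P])
  then have "reaches_base (shear 0 0 (6 * k) (a1, a2, a3, a4, 0, a6, a7, a8, a9, v, w'))"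
    unfolding sh using k by (rule reaches_base_discriminant)
  then show ?thesis
    by (rule reaches_base_shear)
qed

text \<open>If \<open>a5 \<noteq> 0\<close>, some \<open>A + c B\<close> has a square of trace zero,
  as complex square roots exist; the exchange then reduces to \<open>a5 = 0\<close>.\<close>

lemma reaches_base_D3_points:
  assumes P: "P \<in> D3_points w"
  shows "reaches_base P"
proof -
  obtain a1 a2 a3 a4 a5 a6 a7 a8 a9 v w' where P_eq: "P = (a1, a2, a3, a4, a5, a6, a7, a8, a9, v, w')"
    using prod_cases11 by blast
  show ?thesis
  proof (cases "a5 = 0")
    case True
    with P show ?thesis
      unfolding P_eq by (simp add: reaches_base_a5_zero)
  next
    case False
    \<comment> \<open>\<open>c\<close> makes the new \<open>a3\<close> vanish.\<close>
    define c where "c = (csqrt (a4^2 - a3 * a5) - a4) / a5"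
    have "a5 * (a3 + 2 * (c * a4) + c^2 * a5) = (c * a5 + a4)^2 - (a4^2 - a3 * a5)"
      by algebra
    also have "c * a5 + a4 = csqrt (a4^2 - a3 * a5)"
      using False by (simp add: c_def)
    finally have c: "a3 + 2 * (c * a4) + c^2 * a5 = 0"
      using False by simp
    obtain b4 b6 b7 b8 where Q: "swap11 (shear 0 c 0 P) = (a2, a1, a5, b4, 0, a9, b8, b7, b6, v, - w')"
      using c by (simp add: P_eq shear_def Let_def swap11_def)
    have "swap11 (shear 0 c 0 P) \<in> D3_points (- w)"
      by (intro swap11_in_D3_points shear_in_D3_points P)
    then have "reaches_base (swap11 (shear 0 c 0 P))"
      unfolding Q by (rule reaches_base_a5_zero)
    then show ?thesis
      using reaches_base_shear reaches_base_swap11 by blast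
  qed
qed

text \<open>Steps keep the coordinate \<open>w\<close>, which settles the choice left open in
  \<open>reaches_base\<close>.\<close>

lemma shear_steps_base_point:
  assumes "P \<in> D3_points w"
  shows "shear_step\<^sup>*\<^sup>* P (base_point w)"
proof -
  obtain u where u: "shear_step\<^sup>*\<^sup>* P (base_point u)"
    using reaches_base_D3_points [OF assms] by (auto simp: reaches_base_def)
  then have "base_point u \<in> D3_points w"
    using assms by (induction rule: rtranclp_induct) (auto intro: shear_step_in_D3_points)
  then have "u = w"
    by (simp add: base_point_def D3_points_iff)
  with u show ?thesis
    by simp
qed

section \<open>Normal form of composites of elementary maps\<close>

definition affine_map :: "complex \<Rightarrow> complex \<Rightarrow> complex \<Rightarrow> complex \<Rightarrow> complex \<Rightarrow> complex
    \<Rightarrow> mat3 \<times> mat3 \<Rightarrow> mat3 \<times> mat3" where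
  "affine_map a b c d e g = (\<lambda>(X, Y). (smat a X + smat b Y + mat e, smat c X + smat d Y + mat g))"

definition affine_maps :: "(mat3 \<times> mat3 \<Rightarrow> mat3 \<times> mat3) set" where
  "affine_maps = {affine_map a b c d e g | a b c d e g. a * d - b * c \<noteq> 0}"

text \<open>
  The condition \<open>c \<noteq> 0\<close> says that the affine map between two \<open>mat_Phi\<close> factors is not triangular. It
  makes the degrees multiply; a triangular factor could be absorbed into its neighbours.
\<close>

inductive_set reduced_maps :: "(mat3 \<times> mat3 \<Rightarrow> mat3 \<times> mat3) set" where
  base: "2 \<le> degree p \<Longrightarrow> f \<in> affine_maps \<Longrightarrow> mat_Phi p \<circ> f \<in> reduced_maps"
| step: "2 \<le> degree p \<Longrightarrow> a * d - b * c \<noteq> 0 \<Longrightarrow> c \<noteq> 0 \<Longrightarrow> f \<in> reduced_maps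
    \<Longrightarrow> mat_Phi p \<circ> affine_map a b c d e g \<circ> f \<in> reduced_maps"

text \<open>Normal forms in the amalgamated product of the affine and the triangular group. One kind
  of nonlinear factor suffices because \<open>mat_Psi\<close> is \<open>mat_Phi\<close> conjugated
  by the affine map \<open>prod.swap\<close>.\<close>

definition normal_maps :: "(mat3 \<times> mat3 \<Rightarrow> mat3 \<times> mat3) set" where
  "normal_maps = affine_maps \<union> {l \<circ> f | l f. l \<in> affine_maps \<and> f \<in> reduced_maps}"

inductive_set elementary_maps :: "(mat3 \<times> mat3 \<Rightarrow> mat3 \<times> mat3) set" where
  id: "id \<in> elementary_maps"
| Phi: "f \<in> elementary_maps \<Longrightarrow> mat_Phi p \<circ> f \<in> elementary_maps"
| Psi: "f \<in> elementary_maps \<Longrightarrow> mat_Psi q \<circ> f \<in> elementary_maps"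

lemma affine_map_in: "a * d - b * c \<noteq> 0 \<Longrightarrow> affine_map a b c d e g \<in> affine_maps"
  unfolding affine_maps_def by blast

lemma id_affine: "id = affine_map 1 0 0 1 0 0"
  by (simp add: affine_map_def fun_eq_iff)

lemma swap_affine: "prod.swap = affine_map 0 1 1 0 0 0"
  by (simp add: affine_map_def fun_eq_iff)

lemma id_in_affine_maps: "id \<in> affine_maps"
  unfolding id_affine by (rule affine_map_in) simp

lemma swap_in_affine_maps: "prod.swap \<in> affine_maps"
  unfolding swap_affine by (rule affine_map_in) simp

lemma affine_map_comp:
  "affine_map a b c d e g \<circ> affine_map a' b' c' d' e' g' =
   affine_map (a * a' + b * c') (a * b' + b * d') (c * a' + d * c') (c * b' + d * d')
     (a * e' + b * g' + e) (c * e' + d * g' + g)"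
  by (simp add: affine_map_def fun_eq_iff smat_add_right smat_add_left smat_smat smat_mat mat_add algebra_simps)

lemma affine_maps_comp:
  assumes "l \<in> affine_maps" and "m \<in> affine_maps"
  shows "l \<circ> m \<in> affine_maps"
proof -
  obtain a b c d e g where l: "l = affine_map a b c d e g" "a * d - b * c \<noteq> 0"
    using assms(1) by (auto simp: affine_maps_def)
  obtain a' b' c' d' e' g' where m: "m = affine_map a' b' c' d' e' g'" "a' * d' - b' * c' \<noteq> 0"
    using assms(2) by (auto simp: affine_maps_def)
  have "(a * a' + b * c') * (c * b' + d * d') - (a * b' + b * d') * (c * a' + d * c') =
    (a * d - b * c) * (a' * d' - b' * c')"
    by (simp add: algebra_simps)
  with l(2) m(2) show ?thesis
    unfolding l(1) m(1) affine_map_comp by (intro affine_map_in) simp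
qed

lemma mat_Phi_affine:
  assumes "degree p \<le> 1"
  shows "mat_Phi p \<in> affine_maps"
proof -
  have "p = [:coeff p 0, coeff p 1:]"
    using assms degree_eq_zeroE by (auto simp: poly_eq_iff coeff_pCons coeff_eq_0 split: nat.split)
  then obtain e b where p: "p = [:e, b:]"
    by blast
  have "mat_Phi p = affine_map 1 b 0 1 e 0"
    by (simp add: p mat_Phi_def affine_map_def fun_eq_iff mat_poly_pCons mult_mat_right)
  then show ?thesis
    by (simp add: affine_map_in)
qed

text \<open>The polynomial \<open>r\<close> is evaluated at \<open>d Y + g\<close> and, divided by
  \<open>a\<close>, moves through the affine map to merge with \<open>p\<close>.\<close>

lemma mat_Phi_triangular:
  assumes "a \<noteq> 0"
  shows "mat_Phi r \<circ> affine_map a b 0 d e g \<circ> mat_Phi p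
    = affine_map a b 0 d e g \<circ> mat_Phi (p + smult (1 / a) (pcompose r [:g, d:]))"
proof -
  have "mat_poly [:g, d:] Y = smat d Y + mat g" for Y :: mat3
    by (simp add: mat_poly_pCons mult_mat_right)
  then show ?thesis
    using assms
    by (simp add: mat_Phi_def affine_map_def fun_eq_iff mat_poly_add mat_poly_smult mat_poly_pcompose
        smat_add_right smat_smat)
qed

lemma affine_comp_normal_maps:
  assumes "l \<in> affine_maps" and "f \<in> normal_maps"
  shows "l \<circ> f \<in> normal_maps"
  using assms affine_maps_comp unfolding normal_maps_def
  by (auto simp: o_assoc) blast

text \<open>If the affine factor to the right of \<open>mat_Phi r\<close> is not triangular, the
  word gets longer. Otherwise \<open>r\<close> merges with the leading polynomial, and if the degree
  of the result is at most one, that factor is absorbed into the affine maps.\<close>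

lemma mat_Phi_comp_normal_maps:
  assumes "f \<in> normal_maps"
  shows "mat_Phi r \<circ> f \<in> normal_maps"
proof (cases "degree r \<le> 1")
  case True
  then show ?thesis
    using affine_comp_normal_maps assms mat_Phi_affine by blast
next
  case False
  then have r: "2 \<le> degree r"
    by simp
  have red: "f \<in> reduced_maps \<Longrightarrow> f \<in> normal_maps" for f
    using id_in_affine_maps unfolding normal_maps_def by (metis (mono_tags, lifting) UnI2 id_o mem_Collect_eq)
  consider "f \<in> affine_maps" | l h where "f = l \<circ> h" "l \<in> affine_maps" "h \<in> reduced_maps"
    using assms by (auto simp: normal_maps_def)
  then show ?thesis
  proof cases
    case 1
    then show ?thesis
      using r red reduced_maps.base by blast
  next
    case (2 l h)
    obtain a b c d e g where l: "l = affine_map a b c d e g" "a * d - b * c \<noteq> 0"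
      using 2 by (auto simp: affine_maps_def)
    show ?thesis
    proof (cases "c = 0")
      case False
      then have "mat_Phi r \<circ> affine_map a b c d e g \<circ> h \<in> reduced_maps"
        using r l 2 by (intro reduced_maps.step)
      then show ?thesis
        using red by (simp add: 2 l o_assoc)
    next
      case True
      with l have "a \<noteq> 0"
        by auto
      define s where "s p = p + smult (1 / a) (pcompose r [:g, d:])" for p
      have tri: "mat_Phi r \<circ> l \<circ> mat_Phi p = l \<circ> mat_Phi (s p)" for p
        using mat_Phi_triangular [OF \<open>a \<noteq> 0\<close>] by (simp add: l True s_def)
      have small: "degree (s p) \<le> 1 \<Longrightarrow> l \<circ> mat_Phi (s p) \<in> affine_maps" for p
        by (intro affine_maps_comp mat_Phi_affine 2)
      from \<open>h \<in> reduced_maps\<close> show ?thesis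
      proof cases
        case (base p k)
        have eq: "mat_Phi r \<circ> f = l \<circ> mat_Phi (s p) \<circ> k"
          by (simp add: 2 base o_assoc tri)
        show ?thesis
        proof (cases "degree (s p) \<le> 1")
          case True
          then have "mat_Phi r \<circ> f \<in> affine_maps"
            unfolding eq by (intro affine_maps_comp small base)
          then show ?thesis
            by (simp add: normal_maps_def)
        next
          case False
          then have "mat_Phi (s p) \<circ> k \<in> reduced_maps"
            using base by (intro reduced_maps.base) auto
          then show ?thesis
            unfolding eq o_assoc [symmetric] using 2(2) red affine_comp_normal_maps by blast
        qed
      next
        case (step p a' d' b' c' k e' g')
        have eq: "mat_Phi r \<circ> f = l \<circ> mat_Phi (s p) \<circ> affine_map a' b' c' d' e' g' \<circ> k"
          by (simp add: 2 step o_assoc tri)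
        show ?thesis
        proof (cases "degree (s p) \<le> 1")
          case True
          then have "l \<circ> mat_Phi (s p) \<circ> affine_map a' b' c' d' e' g' \<in> affine_maps"
            by (intro affine_maps_comp [of "l \<circ> mat_Phi (s p)"] small affine_map_in step)
          then show ?thesis
            unfolding eq using red step affine_comp_normal_maps by blast
        next
          case False
          then have "mat_Phi (s p) \<circ> affine_map a' b' c' d' e' g' \<circ> k \<in> reduced_maps"
            using step by (intro reduced_maps.step) auto
          then show ?thesis
            unfolding eq o_assoc [symmetric] using 2(2) red affine_comp_normal_maps by blast
        qed
      qed
    qed
  qed
qed

lemma mat_Psi_eq_swap: "mat_Psi q = prod.swap \<circ> mat_Phi q \<circ> prod.swap"
  by (auto simp: fun_eq_iff mat_Psi_def mat_Phi_def)

lemma elementary_maps_normal: "f \<in> elementary_maps \<Longrightarrow> f \<in> normal_maps"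
proof (induction rule: elementary_maps.induct)
  case id
  then show ?case
    using id_in_affine_maps unfolding normal_maps_def by blast
next
  case (Phi f p)
  then show ?case
    using mat_Phi_comp_normal_maps by blast
next
  case (Psi f q)
  then show ?case
    unfolding mat_Psi_eq_swap o_assoc [symmetric]
    using mat_Phi_comp_normal_maps affine_comp_normal_maps swap_in_affine_maps by blast
qed

section \<open>Degree growth along lines of scalar matrices\<close>

lemma affine_map_mat: "affine_map a b c d e g (mat x, mat y) = (mat (a * x + b * y + e), mat (c * x + d * y + g))"
  by (simp add: affine_map_def smat_mat mat_add)

lemma mat_Phi_mat: "mat_Phi p (mat x, mat y) = (mat (x + poly p y), mat y)"
  by (simp add: mat_Phi_def mat_poly_mat mat_add)

text \<open>The term in \<open>u\<close> dominates, so an affine map that is not triangular gives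
  the second coordinate the larger degree.\<close>

lemma degree_lin_comb:
  fixes u v :: "complex poly"
  assumes "degree v < degree u"
  shows "a \<noteq> 0 \<Longrightarrow> degree (smult a u + smult b v + [:e:]) = degree u"
    and "degree (smult a u + smult b v + [:e:]) \<le> degree u"
proof -
  have small: "degree (smult b v + [:e:]) < degree u"
    using assms by (intro degree_add_less) (auto intro: le_less_trans [OF degree_smult_le])
  show "degree (smult a u + smult b v + [:e:]) = degree u" if "a \<noteq> 0"
    unfolding add.assoc using that small by (subst degree_add_eq_left) auto
  show "degree (smult a u + smult b v + [:e:]) \<le> degree u"
    unfolding add.assoc using small by (intro degree_add_le [of "smult a u"] degree_smult_le) simp
qed

text \<open>Composition with \<open>p\<close> at least doubles the degree of \<open>v\<close>, so
  \<open>u\<close> cannot cancel the leading term.\<close>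

lemma degree_add_pcompose:
  fixes p u v :: "complex poly"
  assumes "2 \<le> degree p" and "degree u \<le> degree v" and "1 \<le> degree v"
  shows "degree v < degree (u + pcompose p v)"
proof -
  have "2 * degree v \<le> degree p * degree v"
    using assms(1) by (rule mult_right_mono) simp
  then have *: "degree v < degree (pcompose p v)"
    using assms(3) by (simp add: degree_pcompose)
  then have "degree (u + pcompose p v) = degree (pcompose p v)"
    using assms by (intro degree_add_eq_right) linarith
  with * show ?thesis
    by simp
qed

text \<open>Induction on the word: the affine factor makes the degree of the second coordinate at
  least that of the first, and \<open>mat_Phi p\<close> then raises the first above it. Hence
  \<open>u\<close> has degree at least 2.\<close>

lemma reduced_maps_line:
  assumes "f \<in> reduced_maps"
  shows "\<exists>\<alpha> \<beta> u v. 1 \<le> degree v \<and> degree v < degree u \<and>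
    (\<forall>t. f (mat (\<alpha> * t), mat (\<beta> * t)) = (mat (poly u t), mat (poly v t)))"
  using assms
proof induction
  case (base p f)
  obtain a b c d e g where f: "f = affine_map a b c d e g" "a * d - b * c \<noteq> 0"
    using base by (auto simp: affine_maps_def)
  then have "c \<noteq> 0 \<or> d \<noteq> 0"
    by auto
  \<comment> \<open>A direction along which the second coordinate of \<open>f\<close> is not
    constant.\<close>
  then obtain \<alpha> \<beta> where \<alpha>\<beta>: "c * \<alpha> + d * \<beta> \<noteq> 0"
    by (metis add.right_neutral add.left_neutral mult.right_neutral mult_zero_right)
  define u v where "u = [:e, a * \<alpha> + b * \<beta>:]" and "v = [:g, c * \<alpha> + d * \<beta>:]"
  have "degree v = 1" "degree u \<le> 1"
    using \<alpha>\<beta> by (simp_all add: u_def v_def)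
  then have "degree v < degree (u + pcompose p v)"
    using base by (intro degree_add_pcompose) auto
  moreover have "(mat_Phi p \<circ> f) (mat (\<alpha> * t), mat (\<beta> * t)) = (mat (poly (u + pcompose p v) t), mat (poly v t))" for t
    by (simp add: f affine_map_mat mat_Phi_mat u_def v_def poly_pcompose algebra_simps)
  ultimately show ?case
    using \<open>degree v = 1\<close> by (metis order_refl)
next
  case (step p a d b c f e g)
  then obtain \<alpha> \<beta> u v where IH: "1 \<le> degree v" "degree v < degree u"
    "\<And>t. f (mat (\<alpha> * t), mat (\<beta> * t)) = (mat (poly u t), mat (poly v t))"
    by blast
  define u' v' where "u' = smult a u + smult b v + [:e:]" and "v' = smult c u + smult d v + [:g:]"
  have deg: "degree v' = degree u" "degree u' \<le> degree u"
    using degree_lin_comb [OF IH(2)] step by (simp_all add: u'_def v'_def)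
  then have "degree v' < degree (u' + pcompose p v')"
    using step IH by (intro degree_add_pcompose) auto
  moreover have "(mat_Phi p \<circ> affine_map a b c d e g \<circ> f) (mat (\<alpha> * t), mat (\<beta> * t))
      = (mat (poly (u' + pcompose p v') t), mat (poly v' t))" for t
    by (simp add: IH affine_map_mat mat_Phi_mat u'_def v'_def poly_pcompose algebra_simps)
  moreover have "1 \<le> degree v'"
    using deg IH by simp
  ultimately show ?case
    by blast
qed

text \<open>An affine map is determined by its values on scalar pairs. A reduced word maps some line
  to a curve of degree at least 2, which no invertible affine map turns back into the line.\<close>

lemma normal_map_eq_id:
  assumes "f \<in> normal_maps" and fix_scalars: "\<And>x y. f (mat x, mat y) = (mat x, mat y)"
  shows "f = id"
proof -
  consider "f \<in> affine_maps" | l h where "f = l \<circ> h" "l \<in> affine_maps" "h \<in> reduced_maps"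
    using assms by (auto simp: normal_maps_def)
  then show ?thesis
  proof cases
    case 1
    then obtain a b c d e g where f: "f = affine_map a b c d e g"
      by (auto simp: affine_maps_def)
    have *: "a * x + b * y + e = x" "c * x + d * y + g = y" for x y
      using fix_scalars [of x y] by (simp_all add: f affine_map_mat mat_eq_iff)
    from *[of 0 0] *[of 1 0] *[of 0 1] have "a = 1" "b = 0" "c = 0" "d = 1" "e = 0" "g = 0"
      by auto
    then show ?thesis
      by (simp add: f id_affine)
  next
    case (2 l h)
    obtain a b c d e g where l: "l = affine_map a b c d e g" "a * d - b * c \<noteq> 0"
      using 2 by (auto simp: affine_maps_def)
    obtain \<alpha> \<beta> u v where uv: "1 \<le> degree v" "degree v < degree u"
      "\<And>t. h (mat (\<alpha> * t), mat (\<beta> * t)) = (mat (poly u t), mat (poly v t))"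
      using reduced_maps_line [OF 2(3)] by blast
    have "poly (smult a u + smult b v + [:e:]) t = poly [:0, \<alpha>:] t"
      "poly (smult c u + smult d v + [:g:]) t = poly [:0, \<beta>:] t" for t
      using fix_scalars [of "\<alpha> * t" "\<beta> * t"]
      by (simp_all add: 2 l uv affine_map_mat mat_eq_iff mult.commute)
    then have eq: "smult a u + smult b v + [:e:] = [:0, \<alpha>:]" "smult c u + smult d v + [:g:] = [:0, \<beta>:]"
      by (simp_all add: poly_eq_poly_eq_iff [symmetric] fun_eq_iff)
    \<comment> \<open>A component in which \<open>u\<close> has nonzero coefficient has the degree
      of \<open>u\<close>, yet equals a polynomial of degree at most 1.\<close>
    have "a \<noteq> 0 \<or> c \<noteq> 0"
      using l by auto
    then have "degree u \<le> 1"
      using degree_lin_comb(1) [OF uv(2), of a b e] degree_lin_comb(1) [OF uv(2), of c d g]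
      unfolding eq by (auto split: if_splits)
    with uv show ?thesis
      by simp
  qed
qed

section \<open>Inverses and uniqueness of elementary maps\<close>

lemma mat_Phi_minus: "mat_Phi (- p) \<circ> mat_Phi p = id" "mat_Phi p \<circ> mat_Phi (- p) = id"
  by (simp_all add: fun_eq_iff mat_Phi_def mat_poly_minus)

lemma mat_Psi_minus: "mat_Psi (- p) \<circ> mat_Psi p = id" "mat_Psi p \<circ> mat_Psi (- p) = id"
  by (simp_all add: fun_eq_iff mat_Psi_def mat_poly_minus)

lemma elementary_maps_comp:
  assumes "f \<in> elementary_maps" and "g \<in> elementary_maps"
  shows "f \<circ> g \<in> elementary_maps"
  using assms
  by (induction) (auto simp: o_assoc [symmetric] intro: elementary_maps.intros)

lemma comp_inverse: "g \<circ> f = id \<Longrightarrow> h' \<circ> h = id \<Longrightarrow> (g \<circ> h') \<circ> (h \<circ> f) = id"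
  by (simp add: fun_eq_iff)

lemma elementary_maps_inverse:
  assumes "f \<in> elementary_maps"
  shows "\<exists>g\<in>elementary_maps. g \<circ> f = id \<and> f \<circ> g = id"
  using assms
proof induction
  case id
  then show ?case
    using elementary_maps.id by (intro bexI [of _ id]) auto
next
  case (Phi f p)
  then obtain g where g: "g \<in> elementary_maps" "g \<circ> f = id" "f \<circ> g = id"
    by blast
  have "mat_Phi (- p) \<in> elementary_maps"
    using elementary_maps.Phi [OF elementary_maps.id] by simp
  moreover have "(g \<circ> mat_Phi (- p)) \<circ> (mat_Phi p \<circ> f) = id" "(mat_Phi p \<circ> f) \<circ> (g \<circ> mat_Phi (- p)) = id"
    by (rule comp_inverse; rule g mat_Phi_minus)+
  ultimately show ?case
    using g(1) elementary_maps_comp by blast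
next
  case (Psi f p)
  then obtain g where g: "g \<in> elementary_maps" "g \<circ> f = id" "f \<circ> g = id"
    by blast
  have "mat_Psi (- p) \<in> elementary_maps"
    using elementary_maps.Psi [OF elementary_maps.id] by simp
  moreover have "(g \<circ> mat_Psi (- p)) \<circ> (mat_Psi p \<circ> f) = id" "(mat_Psi p \<circ> f) \<circ> (g \<circ> mat_Psi (- p)) = id"
    by (rule comp_inverse; rule g mat_Psi_minus)+
  ultimately show ?case
    using g(1) elementary_maps_comp by blast
qed

text \<open>The inverse of \<open>h\<close> composed with \<open>f\<close> fixes all scalar pairs,
  so it is the identity. Thus commuting arguments determine the map on all pairs.\<close>

lemma elementary_maps_eqI:
  assumes "f \<in> elementary_maps" and "h \<in> elementary_maps"
    and "\<And>x y. f (mat x, mat y) = h (mat x, mat y)"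
  shows "f = h"
proof -
  obtain g where g: "g \<in> elementary_maps" "g \<circ> h = id" "h \<circ> g = id"
    using elementary_maps_inverse [OF assms(2)] by blast
  have "(g \<circ> f) (mat x, mat y) = (mat x, mat y)" for x y
    using assms(3) fun_cong [OF g(2)] by simp
  then have "g \<circ> f = id"
    using normal_map_eq_id elementary_maps_normal elementary_maps_comp g(1) assms(1) by blast
  then show ?thesis
    using g(3) by (metis comp_assoc comp_id id_comp)
qed

section \<open>Automorphisms of the polynomial ring\<close>

lemma const2_add: "const2 (a + b) = const2 a + const2 b"
  by (simp add: const2_def)

lemma const2_mult: "const2 (a * b) = const2 a * const2 b"
  by (simp add: const2_def)

lemma const2_0 [simp]: "const2 0 = 0"
  by (simp add: const2_def)

lemma const2_1 [simp]: "const2 1 = 1"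
  by (simp add: const2_def one_pCons)

lemma eval1_0 [simp]: "eval1 0 f = 0"
  by (simp add: eval1_def)

lemma eval1_1 [simp]: "eval1 1 f = 1"
  by (simp add: eval1_def map_poly_1')

lemma eval1_pCons: "eval1 (pCons a p) f = const2 a + f * eval1 p f"
  by (simp add: eval1_def map_poly_pCons)

lemma eval1_add: "eval1 (p + q) f = eval1 p f + eval1 q f"
  by (induction p q rule: poly_induct2) (simp_all add: eval1_pCons const2_add algebra_simps)

lemma eval1_minus: "eval1 (- p) f = - eval1 p f"
  using eval1_add [of p "- p" f] by (simp add: eq_neg_iff_add_eq_0 add.commute)

lemma eval1_smult: "eval1 (smult c p) f = const2 c * eval1 p f"
  by (induction p) (simp_all add: eval1_pCons const2_mult algebra_simps)

lemma eval1_mult: "eval1 (p * q) f = eval1 p f * eval1 q f"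
  by (induction p) (simp_all add: eval1_pCons eval1_add eval1_smult algebra_simps)

lemma subst2_0 [simp]: "subst2 f g 0 = 0"
  by (simp add: subst2_def)

lemma subst2_pCons: "subst2 f g (pCons c F) = eval1 c f + g * subst2 f g F"
  by (simp add: subst2_def map_poly_pCons)

lemma subst2_add: "subst2 f g (F + H) = subst2 f g F + subst2 f g H"
  by (induction F H rule: poly_induct2) (simp_all add: subst2_pCons eval1_add algebra_simps)

lemma subst2_smult: "subst2 f g (smult c F) = eval1 c f * subst2 f g F"
  by (induction F) (simp_all add: subst2_pCons eval1_mult algebra_simps)

lemma subst2_mult: "subst2 f g (F * H) = subst2 f g F * subst2 f g H"
  by (induction F) (simp_all add: subst2_pCons subst2_add subst2_smult algebra_simps)

lemma subst2_const2 [simp]: "subst2 f g (const2 c) = const2 c"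
  by (simp add: const2_def subst2_pCons eval1_pCons)

lemma subst2_var_x [simp]: "subst2 f g var_x = f"
  by (simp add: var_x_def subst2_pCons eval1_pCons)

lemma subst2_var_y [simp]: "subst2 f g var_y = g"
  by (simp add: var_y_def subst2_pCons)

section \<open>Algebra endomorphisms of the polynomial ring\<close>

text \<open>The condition in \<open>cpoly2_aut\<close> without bijectivity, available for
  substitutions before their inverses are known.\<close>

definition cpoly2_hom :: "(cpoly2 \<Rightarrow> cpoly2) \<Rightarrow> bool" where
  "cpoly2_hom \<sigma> \<longleftrightarrow> (\<forall>F H. \<sigma> (F + H) = \<sigma> F + \<sigma> H) \<and> (\<forall>F H. \<sigma> (F * H) = \<sigma> F * \<sigma> H) \<and>
     (\<forall>c. \<sigma> (const2 c) = const2 c)"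

lemma cpoly2_hom_subst2: "cpoly2_hom (subst2 f g)"
  by (simp add: cpoly2_hom_def subst2_add subst2_mult)

lemma cpoly2_hom_id: "cpoly2_hom id"
  by (simp add: cpoly2_hom_def)

lemma cpoly2_hom_comp: "cpoly2_hom \<sigma> \<Longrightarrow> cpoly2_hom \<tau> \<Longrightarrow> cpoly2_hom (\<sigma> \<circ> \<tau>)"
  by (simp add: cpoly2_hom_def)

lemma cpoly2_hom_eval1:
  assumes "cpoly2_hom \<sigma>"
  shows "\<sigma> (eval1 p f) = eval1 p (\<sigma> f)"
proof -
  have "\<sigma> 0 = 0"
    using assms const2_0 unfolding cpoly2_hom_def by metis
  then show ?thesis
    using assms by (induction p) (simp_all add: eval1_pCons cpoly2_hom_def)
qed

text \<open>The two variables generate the algebra: coefficients are polynomials in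
  \<open>var_x\<close>, and the induction peels off powers of \<open>var_y\<close>.\<close>

lemma cpoly2_hom_eqI:
  assumes "cpoly2_hom \<sigma>" and "cpoly2_hom \<tau>" and "\<sigma> var_x = \<tau> var_x" and "\<sigma> var_y = \<tau> var_y"
  shows "\<sigma> = \<tau>"
proof
  fix F
  have const: "[:c:] = eval1 c var_x" for c
  proof (induction c)
    case (pCons a c)
    have "[:pCons a c:] = const2 a + var_x * [:c:]"
      by (simp add: const2_def var_x_def)
    then show ?case
      by (simp only: pCons.IH eval1_pCons)
  qed simp
  have pC: "pCons c F = eval1 c var_x + var_y * F" for c F
    by (simp add: var_y_def flip: const)
  have "\<sigma> 0 = 0" "\<tau> 0 = 0"
    using assms const2_0 unfolding cpoly2_hom_def by metis+
  then show "\<sigma> F = \<tau> F"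
  proof (induction F)
    case (pCons c F)
    have h: "\<rho> (pCons c F) = eval1 c (\<rho> var_x) + \<rho> var_y * \<rho> F" if "cpoly2_hom \<rho>" for \<rho>
      using that cpoly2_hom_eval1 [OF that] unfolding pC cpoly2_hom_def by simp
    show ?case
      using assms pCons by (simp add: h [OF assms(1)] h [OF assms(2)])
  qed simp
qed

lemma cpoly2_hom_aut_Phi: "cpoly2_hom (aut_Phi p)"
  by (simp add: aut_Phi_def cpoly2_hom_subst2)

lemma cpoly2_hom_aut_Psi: "cpoly2_hom (aut_Psi p)"
  by (simp add: aut_Psi_def cpoly2_hom_subst2)

lemma aut_Phi_vars [simp]: "aut_Phi p var_x = var_x + eval1 p var_y" "aut_Phi p var_y = var_y"
  by (simp_all add: aut_Phi_def)

lemma aut_Psi_vars [simp]: "aut_Psi q var_x = var_x" "aut_Psi q var_y = var_y + eval1 q var_x"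
  by (simp_all add: aut_Psi_def)

lemma cpoly2_hom_plus: "cpoly2_hom \<sigma> \<Longrightarrow> \<sigma> (F + H) = \<sigma> F + \<sigma> H"
  by (simp add: cpoly2_hom_def)

lemma cpoly2_hom_minus:
  assumes "cpoly2_hom \<sigma>"
  shows "\<sigma> (- F) = - \<sigma> F"
proof -
  have "\<sigma> (- F) + \<sigma> F = \<sigma> 0"
    by (simp flip: cpoly2_hom_plus [OF assms])
  also have "\<sigma> 0 = 0"
    using assms const2_0 unfolding cpoly2_hom_def by metis
  finally show ?thesis
    by (simp add: eq_neg_iff_add_eq_0)
qed

lemma aut_Phi_minus: "aut_Phi p \<circ> aut_Phi (- p) = id"
proof (rule cpoly2_hom_eqI)
  show "(aut_Phi p \<circ> aut_Phi (- p)) var_x = id var_x"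
    by (simp add: cpoly2_hom_plus [OF cpoly2_hom_aut_Phi] cpoly2_hom_eval1 [OF cpoly2_hom_aut_Phi] eval1_minus
      del: add_uminus_conv_diff) (simp add: cpoly2_hom_minus [OF cpoly2_hom_aut_Phi] cpoly2_hom_eval1 [OF cpoly2_hom_aut_Phi])
qed (simp_all add: cpoly2_hom_comp cpoly2_hom_aut_Phi cpoly2_hom_id)

lemma aut_Psi_minus: "aut_Psi p \<circ> aut_Psi (- p) = id"
proof (rule cpoly2_hom_eqI)
  show "(aut_Psi p \<circ> aut_Psi (- p)) var_y = id var_y"
    by (simp add: cpoly2_hom_plus [OF cpoly2_hom_aut_Psi] cpoly2_hom_eval1 [OF cpoly2_hom_aut_Psi] eval1_minus
      del: add_uminus_conv_diff) (simp add: cpoly2_hom_minus [OF cpoly2_hom_aut_Psi] cpoly2_hom_eval1 [OF cpoly2_hom_aut_Psi])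
qed (simp_all add: cpoly2_hom_comp cpoly2_hom_aut_Psi cpoly2_hom_id)

lemma aut_Phi_minus': "aut_Phi (- p) \<circ> aut_Phi p = id"
  using aut_Phi_minus [of "- p"] by simp

lemma aut_Psi_minus': "aut_Psi (- p) \<circ> aut_Psi p = id"
  using aut_Psi_minus [of "- p"] by simp

section \<open>The automorphism group and the Cremona group\<close>

lemma carrier_cpoly2_aut: "carrier cpoly2_aut = {\<sigma>. bij \<sigma> \<and> cpoly2_hom \<sigma>}"
  by (simp add: cpoly2_aut_def cpoly2_hom_def)

lemma one_cpoly2_aut: "\<one>\<^bsub>cpoly2_aut\<^esub> = id"
  by (simp add: cpoly2_aut_def BijGroup_def fun_eq_iff)

text \<open>The product of \<open>BijGroup\<close> is specified on bijections only, hence the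
  premises.\<close>

lemma mult_cpoly2_aut: "bij \<sigma> \<Longrightarrow> bij \<tau> \<Longrightarrow> \<sigma> \<otimes>\<^bsub>cpoly2_aut\<^esub> \<tau> = \<sigma> \<circ> \<tau>"
  by (simp add: cpoly2_aut_def BijGroup_def Bij_def fun_eq_iff compose_def)

lemma cpoly2_hom_inv:
  assumes "bij \<sigma>" and "cpoly2_hom \<sigma>"
  shows "cpoly2_hom (inv_into UNIV \<sigma>)"
proof -
  define \<tau> where "\<tau> = inv_into UNIV \<sigma>"
  have \<tau>: "\<tau> (\<sigma> F) = F" "\<sigma> (\<tau> F) = F" for F
    using assms(1) by (simp_all add: \<tau>_def bij_is_inj bij_is_surj surj_f_inv_f)
  have "\<tau> (F + H) = \<tau> F + \<tau> H" "\<tau> (F * H) = \<tau> F * \<tau> H" "\<tau> (const2 c) = const2 c" for F H c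
    using assms(2) \<tau> unfolding cpoly2_hom_def by metis+
  then show ?thesis
    by (simp add: cpoly2_hom_def flip: \<tau>_def)
qed

lemma group_cpoly2_aut: "group cpoly2_aut"
proof (rule groupI)
  fix \<sigma> assume \<sigma>: "\<sigma> \<in> carrier cpoly2_aut"
  then have "inv_into UNIV \<sigma> \<in> carrier cpoly2_aut" "inv_into UNIV \<sigma> \<otimes>\<^bsub>cpoly2_aut\<^esub> \<sigma> = \<one>\<^bsub>cpoly2_aut\<^esub>"
    by (simp_all add: carrier_cpoly2_aut mult_cpoly2_aut one_cpoly2_aut bij_imp_bij_inv cpoly2_hom_inv
        bij_is_inj)
  then show "\<exists>\<tau>\<in>carrier cpoly2_aut. \<tau> \<otimes>\<^bsub>cpoly2_aut\<^esub> \<sigma> = \<one>\<^bsub>cpoly2_aut\<^esub>"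
    by blast
qed (auto simp: carrier_cpoly2_aut mult_cpoly2_aut one_cpoly2_aut bij_comp cpoly2_hom_comp cpoly2_hom_id
    o_assoc)

lemma aut_Phi_in_carrier: "aut_Phi p \<in> carrier cpoly2_aut"
  using aut_Phi_minus [of p] aut_Phi_minus' [of p] by (auto simp: carrier_cpoly2_aut cpoly2_hom_aut_Phi intro: o_bij)

lemma aut_Psi_in_carrier: "aut_Psi p \<in> carrier cpoly2_aut"
  using aut_Psi_minus [of p] aut_Psi_minus' [of p] by (auto simp: carrier_cpoly2_aut cpoly2_hom_aut_Psi intro: o_bij)

lemma carrier_cremona_group:
  "carrier cremona_group = generate cpoly2_aut (range aut_Phi \<union> range aut_Psi)"
proof -
  have "carrier cpoly2_aut \<inter> (range aut_Phi \<union> range aut_Psi) = range aut_Phi \<union> range aut_Psi"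
    using aut_Phi_in_carrier aut_Psi_in_carrier by auto
  then show ?thesis
    by (simp add: cremona_group_def carrier_subgroup_generated)
qed

lemma group_cremona_group: "group cremona_group"
  unfolding cremona_group_def by (rule group.group_subgroup_generated [OF group_cpoly2_aut])

lemma carrier_cremona_group_subset: "carrier cremona_group \<subseteq> carrier cpoly2_aut"
  unfolding cremona_group_def by (rule group.carrier_subgroup_generated_subset [OF group_cpoly2_aut])

lemma mult_cremona_group:
  assumes "\<sigma> \<in> carrier cremona_group" and "\<tau> \<in> carrier cremona_group"
  shows "\<sigma> \<otimes>\<^bsub>cremona_group\<^esub> \<tau> = \<sigma> \<circ> \<tau>"
  using assms carrier_cremona_group_subset mult_cpoly2_aut
  by (auto simp: cremona_group_def carrier_cpoly2_aut subset_iff)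

lemma one_cremona_group: "\<one>\<^bsub>cremona_group\<^esub> = id"
  by (simp add: cremona_group_def one_cpoly2_aut)

lemma inv_aut_Phi: "inv\<^bsub>cpoly2_aut\<^esub> (aut_Phi p) = aut_Phi (- p)"
proof (rule group.inv_equality [OF group_cpoly2_aut _ aut_Phi_in_carrier aut_Phi_in_carrier])
  show "aut_Phi (- p) \<otimes>\<^bsub>cpoly2_aut\<^esub> aut_Phi p = \<one>\<^bsub>cpoly2_aut\<^esub>"
    using aut_Phi_in_carrier by (simp add: mult_cpoly2_aut one_cpoly2_aut aut_Phi_minus' carrier_cpoly2_aut)
qed

lemma inv_aut_Psi: "inv\<^bsub>cpoly2_aut\<^esub> (aut_Psi p) = aut_Psi (- p)"
proof (rule group.inv_equality [OF group_cpoly2_aut _ aut_Psi_in_carrier aut_Psi_in_carrier])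
  show "aut_Psi (- p) \<otimes>\<^bsub>cpoly2_aut\<^esub> aut_Psi p = \<one>\<^bsub>cpoly2_aut\<^esub>"
    using aut_Psi_in_carrier by (simp add: mult_cpoly2_aut one_cpoly2_aut aut_Psi_minus' carrier_cpoly2_aut)
qed

section \<open>From automorphisms to maps of matrix pairs\<close>

text \<open>Maps of pairs compose in the order opposite to automorphisms, as substitution is
  contravariant.\<close>

lemma mat_action_graph_comp:
  assumes "(\<tau>, g) \<in> mat_action_graph" and "(\<sigma>, f) \<in> mat_action_graph"
  shows "(\<sigma> \<circ> \<tau>, g \<circ> f) \<in> mat_action_graph"
  using assms(1)
proof induction
  case id
  then show ?case
    using assms(2) by simp
next
  case (Phi \<tau> g p)
  then show ?case
    using mat_action_graph.Phi [OF Phi.IH] by (simp only: o_assoc)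
next
  case (Psi \<tau> g q)
  then show ?case
    using mat_action_graph.Psi [OF Psi.IH] by (simp only: o_assoc)
qed

lemma mat_action_graph_in_carrier:
  assumes "(\<sigma>, f) \<in> mat_action_graph"
  shows "\<sigma> \<in> carrier cremona_group"
  using assms
proof induction
  case id
  then show ?case
    using group.is_monoid [OF group_cremona_group] by (metis monoid.one_closed one_cremona_group)
next
  case (Phi \<sigma> f p)
  have "aut_Phi p \<in> carrier cremona_group"
    by (auto simp: carrier_cremona_group intro: generate.incl)
  with Phi show ?case
    by (metis mult_cremona_group group.subgroup_self group_cremona_group subgroup.m_closed)
next
  case (Psi \<sigma> f p)
  have "aut_Psi p \<in> carrier cremona_group"
    by (auto simp: carrier_cremona_group intro: generate.incl)
  with Psi show ?case
    by (metis mult_cremona_group group.subgroup_self group_cremona_group subgroup.m_closed)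
qed

text \<open>Inverses of generators are generators with the negated polynomial, so the graph reaches
  the whole group.\<close>

lemma carrier_cremona_group_graph:
  assumes "\<sigma> \<in> carrier cremona_group"
  shows "\<exists>f. (\<sigma>, f) \<in> mat_action_graph"
  using assms unfolding carrier_cremona_group
proof induction
  case one
  then show ?case
    unfolding one_cpoly2_aut using mat_action_graph.id by blast
next
  case (incl h)
  then show ?case
    using mat_action_graph.Phi [OF mat_action_graph.id] mat_action_graph.Psi [OF mat_action_graph.id]
    by auto
next
  case (inv h)
  then show ?case
    using mat_action_graph.Phi [OF mat_action_graph.id] mat_action_graph.Psi [OF mat_action_graph.id]
    by (auto simp: inv_aut_Phi inv_aut_Psi) blast+
next
  case (eng h1 h2)
  then have "h1 \<in> carrier cpoly2_aut" "h2 \<in> carrier cpoly2_aut"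
    using carrier_cremona_group_subset by (auto simp: carrier_cremona_group)
  then have "h1 \<otimes>\<^bsub>cpoly2_aut\<^esub> h2 = h1 \<circ> h2"
    by (simp add: carrier_cpoly2_aut mult_cpoly2_aut)
  with eng show ?case
    using mat_action_graph_comp by metis
qed

section \<open>The action on the quotient\<close>

definition eval2 :: "cpoly2 \<Rightarrow> complex \<Rightarrow> complex \<Rightarrow> complex" where
  "eval2 F x y = poly (poly F [:y:]) x"

lemma eval2_add: "eval2 (F + H) x y = eval2 F x y + eval2 H x y"
  by (simp add: eval2_def)

lemma eval2_eval1: "eval2 (eval1 p F) x y = poly p (eval2 F x y)"
  by (induction p) (simp_all add: eval1_pCons eval2_def const2_def)

lemma eval2_vars: "eval2 var_x x y = x" "eval2 var_y x y = y"
  by (simp_all add: eval2_def var_x_def var_y_def)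

lemma mat_Psi_mat: "mat_Psi q (mat x, mat y) = (mat x, mat (y + poly q x))"
  by (simp add: mat_Psi_def mat_poly_mat mat_add)

lemma mat_action_graph_hom: "(\<sigma>, f) \<in> mat_action_graph \<Longrightarrow> cpoly2_hom \<sigma>"
  by (induction rule: mat_action_graph.induct)
    (blast intro: cpoly2_hom_id cpoly2_hom_comp cpoly2_hom_aut_Phi cpoly2_hom_aut_Psi)+

lemma mat_action_graph_elementary: "(\<sigma>, f) \<in> mat_action_graph \<Longrightarrow> f \<in> elementary_maps"
  by (induction rule: mat_action_graph.induct) (blast intro: elementary_maps.intros)+

text \<open>Scalar matrices commute, so on them the action is ordinary evaluation and depends on
  \<open>\<sigma>\<close> alone.\<close>

lemma mat_action_graph_scalar:
  "(\<sigma>, f) \<in> mat_action_graph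
    \<Longrightarrow> f (mat x, mat y) = (mat (eval2 (\<sigma> var_x) x y), mat (eval2 (\<sigma> var_y) x y))"
proof (induction rule: mat_action_graph.induct)
  case id
  then show ?case
    by (simp add: eval2_vars)
next
  case (Phi \<sigma> f p)
  from Phi.hyps have "cpoly2_hom \<sigma>"
    by (rule mat_action_graph_hom)
  with Phi show ?case
    by (simp add: mat_Phi_mat cpoly2_hom_plus cpoly2_hom_eval1 eval2_add eval2_eval1)
next
  case (Psi \<sigma> f q)
  from Psi.hyps have "cpoly2_hom \<sigma>"
    by (rule mat_action_graph_hom)
  with Psi show ?case
    by (simp add: mat_Psi_mat cpoly2_hom_plus cpoly2_hom_eval1 eval2_add eval2_eval1)
qed

text \<open>Two maps attached to one automorphism agree on scalar pairs and are therefore equal, so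
  the description in \<open>mat_action\<close> is unique.\<close>

lemma mat_action_eqI:
  assumes "(\<sigma>, f) \<in> mat_action_graph"
  shows "mat_action \<sigma> = f"
  unfolding mat_action_def
proof (rule the_equality)
  show "(\<sigma>, f) \<in> mat_action_graph"
    by (rule assms)
next
  fix h assume "(\<sigma>, h) \<in> mat_action_graph"
  with assms show "h = f"
    by (intro elementary_maps_eqI) (simp_all add: mat_action_graph_elementary mat_action_graph_scalar)
qed

text \<open>The commutator changes sign, hence so does the trace of its cube, while that of its
  square stays.\<close>

lemma invariants_swap: "invariants (Y, X) = swap11 (invariants (X, Y))"
proof -
  define A where "A = X - mat (trace X / 3)"
  define B where "B = Y - mat (trace Y / 3)"
  define C where "C = A ** B - B ** A"
  have C': "B ** A - A ** B = smat (- 1) C"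
    by (simp add: C_def smat_minus_left)
  have "trace (B ** A) = trace (A ** B)" "trace (B ** (B ** A)) = trace (A ** (B ** B))"
    "trace (B ** (A ** A)) = trace (A ** (A ** B))"
    by (simp_all add: trace_mul_sym [of B A] trace_cyclic [of A B B] trace_cyclic [of B A A])
  then show ?thesis
    unfolding invariants_eq A_def [symmetric] B_def [symmetric] commutator_invariants C_def [symmetric] C'
    by (simp add: swap11_def smat_mult_left smat_mult_right smat_smat trace_smat)
qed

lemma invariants_mat_Psi: "invariants (mat_Psi q (X, Y)) = swap11 (invariants (mat_Phi q (Y, X)))"
proof -
  obtain X' Y' where "mat_Phi q (Y, X) = (X', Y')"
    by fastforce
  then show ?thesis
    by (simp add: mat_Psi_eq_swap invariants_swap [of Y' X'])
qed

text \<open>\<open>Q\<close> is chosen before \<open>X\<close> and \<open>Y\<close>: the new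
  invariants depend only on the old ones. Each generator acts as a shear, up to exchange, and shears
  preserve the relations.\<close>

lemma mat_action_graph_invariants:
  assumes "(\<sigma>, f) \<in> mat_action_graph"
  shows "\<exists>Q. (\<forall>X Y. invariants (X, Y) = P \<longrightarrow> invariants (f (X, Y)) = Q)
    \<and> (\<forall>w. P \<in> D3_points w \<longrightarrow> Q \<in> D3_points w)"
  using assms
proof induction
  case id
  then show ?case
    by (intro exI [of _ P]) simp
next
  case (Phi \<sigma> f p)
  then obtain Q where Q: "\<And>X Y. invariants (X, Y) = P \<Longrightarrow> invariants (f (X, Y)) = Q"
    "\<And>w. P \<in> D3_points w \<Longrightarrow> Q \<in> D3_points w"
    by blast
  obtain c0 c1 c2 where "\<And>X Y. invariants (X, Y) = Q \<Longrightarrow> invariants (mat_Phi p (X, Y)) = shear c0 c1 c2 Q"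
    using invariants_mat_Phi by blast
  then have "invariants (X, Y) = P \<Longrightarrow> invariants ((mat_Phi p \<circ> f) (X, Y)) = shear c0 c1 c2 Q" for X Y
    using Q(1) by (metis comp_apply surj_pair)
  with Q(2) shear_in_D3_points show ?case
    by blast
next
  case (Psi \<sigma> f p)
  then obtain Q where Q: "\<And>X Y. invariants (X, Y) = P \<Longrightarrow> invariants (f (X, Y)) = Q"
    "\<And>w. P \<in> D3_points w \<Longrightarrow> Q \<in> D3_points w"
    by blast
  obtain c0 c1 c2 where c: "\<And>X Y. invariants (X, Y) = swap11 Q
      \<Longrightarrow> invariants (mat_Phi p (X, Y)) = shear c0 c1 c2 (swap11 Q)"
    using invariants_mat_Phi by blast
  have "invariants (X, Y) = Q \<Longrightarrow> invariants (mat_Psi p (X, Y)) = swap11 (shear c0 c1 c2 (swap11 Q))" for X Y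
    using c [of Y X] by (simp add: invariants_mat_Psi invariants_swap [of Y X])
  then have "invariants (X, Y) = P \<Longrightarrow> invariants ((mat_Psi p \<circ> f) (X, Y)) = swap11 (shear c0 c1 c2 (swap11 Q))" for X Y
    using Q(1) by (metis comp_apply surj_pair)
  moreover have "P \<in> D3_points w \<Longrightarrow> swap11 (shear c0 c1 c2 (swap11 Q)) \<in> D3_points w" for w
    using swap11_in_D3_points [OF shear_in_D3_points [OF swap11_in_D3_points [OF Q(2)]]] by simp
  ultimately show ?case
    by blast
qed

text \<open>Each shear on the path is realised by a generator at the point reached so far, and these
  generators compose.\<close>

lemma shear_steps_lift:
  assumes "shear_step\<^sup>*\<^sup>* P Q"
  shows "\<exists>\<sigma> f. (\<sigma>, f) \<in> mat_action_graph \<and> (\<forall>X Y. invariants (X, Y) = P \<longrightarrow> invariants (f (X, Y)) = Q)"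
  using assms
proof induction
  case base
  then show ?case
    using mat_action_graph.id by (metis id_apply)
next
  case (step Q R)
  then obtain \<sigma> f where f: "(\<sigma>, f) \<in> mat_action_graph"
    "\<And>X Y. invariants (X, Y) = P \<Longrightarrow> invariants (f (X, Y)) = Q"
    by blast
  from step(2) consider c0 c1 c2 where "R = shear c0 c1 c2 Q"
    | c0 c1 c2 where "R = swap11 (shear c0 c1 c2 (swap11 Q))"
    unfolding shear_step_def by blast
  then show ?case
  proof cases
    case (1 c0 c1 c2)
    then obtain p where "\<And>X Y. invariants (X, Y) = Q \<Longrightarrow> invariants (mat_Phi p (X, Y)) = R"
      using shear_mat_Phi by blast
    then have "invariants (X, Y) = P \<Longrightarrow> invariants ((mat_Phi p \<circ> f) (X, Y)) = R" for X Y
      using f(2) by (metis comp_apply surj_pair)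
    with mat_action_graph.Phi [OF f(1)] show ?thesis
      by blast
  next
    case (2 c0 c1 c2)
    obtain p where p: "\<And>X Y. invariants (X, Y) = swap11 Q
        \<Longrightarrow> invariants (mat_Phi p (X, Y)) = shear c0 c1 c2 (swap11 Q)"
      using shear_mat_Phi by blast
    have "invariants (X, Y) = Q \<Longrightarrow> invariants (mat_Psi p (X, Y)) = R" for X Y
      using p [of Y X] by (simp add: 2 invariants_mat_Psi invariants_swap [of Y X])
    then have "invariants (X, Y) = P \<Longrightarrow> invariants ((mat_Psi p \<circ> f) (X, Y)) = R" for X Y
      using f(2) by (metis comp_apply surj_pair)
    with mat_action_graph.Psi [OF f(1)] show ?thesis
      by blast
  qed
qed

section \<open>Matrix pairs over the points of the variety\<close>

lemma base_point_invariants: "\<exists>X Y. invariants (X, Y) = base_point 2"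
proof -
  \<comment> \<open>Two opposite weighted shifts with commutator \<open>diag(-1, -1, 2)\<close>. Its
    square and cube have trace 6, which gives \<open>v = - 3\<close> and \<open>w = 2\<close>; words
    with unequal numbers of \<open>X\<close> and \<open>Y\<close> have trace zero.\<close>
  define X :: mat3 where "X = vector [vector [0, 0, 0], vector [1, 0, 0], vector [0, 2, 0]]"
  define Y :: mat3 where "Y = vector [vector [0, 1, 0], vector [0, 0, 1], vector [0, 0, 0]]"
  have "trace X = 0" "trace Y = 0"
    by (simp_all add: X_def Y_def trace_def sum_3)
  then have "invariants (X, Y) = base_point 2"
    by (simp add: invariants_eq base_point_def trace_def sum_3 matrix_matrix_mult_def X_def Y_def)
  then show ?thesis
    by blast
qed

text \<open>The pair over the base point is carried to \<open>P\<close> along reversed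
  steps.\<close>

lemma D3_points_invariants:
  assumes "P \<in> D3_points 2"
  shows "\<exists>X Y. invariants (X, Y) = P"
proof -
  obtain X Y where "invariants (X, Y) = base_point 2"
    using base_point_invariants by blast
  moreover obtain \<sigma> f where "\<And>X Y. invariants (X, Y) = base_point 2 \<Longrightarrow> invariants (f (X, Y)) = P"
    using shear_steps_lift [OF shear_steps_sym [OF shear_steps_base_point [OF assms]]] by blast
  ultimately show ?thesis
    by (metis surj_pair)
qed

text \<open>For \<open>v = - 3\<close>, \<open>w = 2\<close> the terms
  \<open>w^2 + 4 * v^3 / 27\<close> cancel, and the others are quadratic in the relations.\<close>

lemma C2_times_D3_subset_hypersurface: "C2_times_D3 \<subseteq> quotient_hypersurface"
proof
  fix P assume P: "P \<in> C2_times_D3"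
  obtain a1 a2 a3 a4 a5 a6 a7 a8 a9 v w where P_eq: "P = (a1, a2, a3, a4, a5, a6, a7, a8, a9, v, w)"
    using prod_cases11 by blast
  have v: "v = - 3" "w = 2"
    and e: "a3 * a9 - 2 * a4 * a8 + a5 * a7 = 0" "a5 * a6 - 2 * a4 * a7 + a3 * a8 = 0"
    "9 * a3 - a3 * a4^2 + a3^2 * a5 + 6 * a6 * a8 - 6 * a7^2 = 0"
    "9 * a4 - a4^3 + a3 * a4 * a5 + 3 * a6 * a9 - 3 * a7 * a8 = 0"
    "9 * a5 - a4^2 * a5 + a3 * a5^2 + 6 * a7 * a9 - 6 * a8^2 = 0"
    using P by (simp_all add: C2_times_D3_eq P_eq D3_points_iff D3_iff)
  have r: "a3 * a8 - 2 * a4 * a7 + a5 * a6 = 0"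
    "a3 * (a3 * a5 - a4^2 - 3 * - 3) + 6 * (a6 * a8 - a7^2) = 0"
    "a4 * (a3 * a5 - a4^2 - 3 * - 3) + 3 * (a6 * a9 - a7 * a8) = 0"
    using e(2-4) by (simp_all add: algebra_simps power2_eq_square power3_eq_cube)
  show "P \<in> quotient_hypersurface"
    unfolding quotient_hypersurface_def P_eq mem_Collect_eq prod.case Let_def v e(1) r
    by simp
qed

section \<open>The induced action and its transitivity\<close>

text \<open>The value is the same for all pairs over \<open>P\<close>, and the given pair shows that
  there is one; so \<open>THE\<close> is justified.\<close>

lemma cremona_action_eq:
  assumes "(\<sigma>, f) \<in> mat_action_graph" and "P \<in> C2_times_D3" and "invariants (X, Y) = P"
  shows "cremona_action \<sigma> P = invariants (f (X, Y))" and "cremona_action \<sigma> P \<in> C2_times_D3"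
proof -
  obtain Q where Q: "\<And>X Y. invariants (X, Y) = P \<Longrightarrow> invariants (f (X, Y)) = Q"
    "\<And>w. P \<in> D3_points w \<Longrightarrow> Q \<in> D3_points w"
    using mat_action_graph_invariants [OF assms(1), of P] by blast
  have "P \<in> quotient_hypersurface"
    using assms(2) C2_times_D3_subset_hypersurface by blast
  then have "cremona_action \<sigma> P = (THE Q. \<exists>X Y. invariants (X, Y) = P \<and> invariants (f (X, Y)) = Q)"
    by (simp add: cremona_action_def mat_action_eqI [OF assms(1)])
  also have "\<dots> = Q"
    using Q(1) assms(3) by (intro the_equality) blast+
  finally have "cremona_action \<sigma> P = Q" .
  then show "cremona_action \<sigma> P = invariants (f (X, Y))" "cremona_action \<sigma> P \<in> C2_times_D3"
    using Q assms(2,3) by (simp_all add: C2_times_D3_eq)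
qed

lemma cremona_action_closed:
  assumes "\<sigma> \<in> carrier cremona_group" and "P \<in> C2_times_D3"
  shows "cremona_action \<sigma> P \<in> C2_times_D3"
  using assms carrier_cremona_group_graph D3_points_invariants cremona_action_eq(2)
  unfolding C2_times_D3_eq by metis

lemma cremona_action_id:
  assumes "P \<in> C2_times_D3"
  shows "cremona_action id P = P"
proof -
  obtain X Y where "invariants (X, Y) = P"
    using assms D3_points_invariants C2_times_D3_eq by blast
  then show ?thesis
    using cremona_action_eq(1) [OF mat_action_graph.id assms] by simp
qed

lemma cremona_action_comp:
  assumes "\<sigma> \<in> carrier cremona_group" and "\<tau> \<in> carrier cremona_group" and P: "P \<in> C2_times_D3"
  shows "cremona_action (\<sigma> \<circ> \<tau>) P = cremona_action \<tau> (cremona_action \<sigma> P)"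
proof -
  obtain f g where f: "(\<sigma>, f) \<in> mat_action_graph" and g: "(\<tau>, g) \<in> mat_action_graph"
    using assms carrier_cremona_group_graph by blast
  obtain X Y where XY: "invariants (X, Y) = P"
    using P D3_points_invariants C2_times_D3_eq by blast
  obtain X' Y' where XY': "f (X, Y) = (X', Y')"
    by fastforce
  have "cremona_action \<sigma> P = invariants (X', Y')" "cremona_action \<sigma> P \<in> C2_times_D3"
    using cremona_action_eq [OF f P XY] by (simp_all add: XY')
  then show ?thesis
    using cremona_action_eq(1) [OF mat_action_graph_comp [OF g f] P XY] cremona_action_eq(1) [OF g] XY'
    by simp
qed

lemma group_opposite_group:
  assumes "group G"
  shows "group (opposite_group G)"
proof -
  interpret group G by fact
  show ?thesis
    by (rule groupI) (auto simp: opposite_group_def m_assoc intro: r_inv_ex)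
qed

text \<open>Since \<open>\<sigma> \<circ> \<tau>\<close> acts by \<open>\<sigma>\<close> first, the
  opposite group gives a left action. Restriction makes the maps extensional, as \<open>Bij\<close>
  demands.\<close>

theorem theorem6p1:
  shows "transitive_action (opposite_group cremona_group) C2_times_D3
    (\<lambda>\<sigma>. restrict (cremona_action \<sigma>) C2_times_D3)"
proof -
  interpret G: group cremona_group
    by (rule group_cremona_group)
  let ?\<phi> = "\<lambda>\<sigma>. restrict (cremona_action \<sigma>) C2_times_D3"
  have carrier: "carrier (opposite_group cremona_group) = carrier cremona_group"
    by (simp add: opposite_group_def)
  have Bij: "?\<phi> \<sigma> \<in> Bij C2_times_D3" if \<sigma>: "\<sigma> \<in> carrier cremona_group" for \<sigma>
  proof -
    define \<tau> where "\<tau> = inv\<^bsub>cremona_group\<^esub> \<sigma>"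
    have \<tau>: "\<tau> \<in> carrier cremona_group"
      using \<sigma> by (simp add: \<tau>_def)
    have "\<sigma> \<circ> \<tau> = id" "\<tau> \<circ> \<sigma> = id"
      using \<sigma> \<tau> G.r_inv [OF \<sigma>] G.l_inv [OF \<sigma>] by (simp_all add: \<tau>_def mult_cremona_group one_cremona_group)
    then have "bij_betw (?\<phi> \<sigma>) C2_times_D3 C2_times_D3"
      using cremona_action_comp [OF \<sigma> \<tau>] cremona_action_comp [OF \<tau> \<sigma>] cremona_action_id
        cremona_action_closed \<sigma> \<tau>
      by (intro bij_betw_byWitness [where f' = "cremona_action \<tau>"]) auto
    then show ?thesis
      by (simp add: Bij_def)
  qed
  have "?\<phi> \<in> hom (opposite_group cremona_group) (BijGroup C2_times_D3)"
  proof (rule homI)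
    fix \<sigma> \<tau> assume "\<sigma> \<in> carrier (opposite_group cremona_group)" "\<tau> \<in> carrier (opposite_group cremona_group)"
    then have \<sigma>\<tau>: "\<sigma> \<in> carrier cremona_group" "\<tau> \<in> carrier cremona_group"
      by (simp_all add: carrier)
    then have "?\<phi> (\<sigma> \<otimes>\<^bsub>opposite_group cremona_group\<^esub> \<tau>) = compose C2_times_D3 (?\<phi> \<sigma>) (?\<phi> \<tau>)"
      by (auto simp: opposite_group_def mult_cremona_group compose_def fun_eq_iff cremona_action_comp
          cremona_action_closed)
    also have "\<dots> = ?\<phi> \<sigma> \<otimes>\<^bsub>BijGroup C2_times_D3\<^esub> ?\<phi> \<tau>"
      using Bij \<sigma>\<tau> by (simp add: BijGroup_def)
    finally show "?\<phi> (\<sigma> \<otimes>\<^bsub>opposite_group cremona_group\<^esub> \<tau>) = ?\<phi> \<sigma> \<otimes>\<^bsub>BijGroup C2_times_D3\<^esub> ?\<phi> \<tau>" .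
  qed (use Bij in \<open>simp add: carrier BijGroup_def\<close>)
  then have "group_action (opposite_group cremona_group) C2_times_D3 ?\<phi>"
    by (intro group_action.intro group_hom.intro group_opposite_group group_hom_axioms.intro
        group_BijGroup G.is_group)
  moreover have "\<exists>\<sigma>\<in>carrier (opposite_group cremona_group). ?\<phi> \<sigma> P = Q"
    if P: "P \<in> C2_times_D3" and Q: "Q \<in> C2_times_D3" for P Q
  proof -
    \<comment> \<open>Both points are joined to the base point, and steps are reversible.\<close>
    have "shear_step\<^sup>*\<^sup>* P (base_point 2)" "shear_step\<^sup>*\<^sup>* (base_point 2) Q"
      using P Q shear_steps_base_point shear_steps_sym by (auto simp: C2_times_D3_eq)
    then have "shear_step\<^sup>*\<^sup>* P Q"
      by (rule rtranclp_trans)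
    then obtain \<sigma> f where f: "(\<sigma>, f) \<in> mat_action_graph"
      "\<And>X Y. invariants (X, Y) = P \<Longrightarrow> invariants (f (X, Y)) = Q"
      using shear_steps_lift by blast
    obtain X Y where "invariants (X, Y) = P"
      using P D3_points_invariants C2_times_D3_eq by blast
    then have "cremona_action \<sigma> P = Q"
      using cremona_action_eq(1) [OF f(1) P] f(2) by simp
    with P mat_action_graph_in_carrier [OF f(1)] show ?thesis
      by (auto simp: carrier)
  qed
  ultimately show ?thesis
    by (intro transitive_action.intro transitive_action_axioms.intro)
qed

end
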